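(* Let $(S,\Sigma)$ be a measurable space, $\mu$ a probability measure on $(S,\Sigma)$, and $X$ a Banach space. For a countably additive vector measure $F:\Sigma\to X$ the following assertions are equivalent: (1) $F$ has bounded $\gamma$-variation with respect to $\mu$; (2) there exists a $\gamma$-summing operator $T:L^2(\mu)\to X$ such that $$F(A)=T1_A,\quad A\in\Sigma.$$ In this situation we have $$\|F\|_{V_\gamma(\mu;X)}=\|T\|_{\gamma_\infty(L^2(\mu),X)}.$$
   Context: Let $(\gamma_n)_{n\ge 1}$ be a sequence of independent standard Gaussian random variables on a probability space $(\Omega,\mathscr{F},\mathbb{P})$, with expectation $\mathbb{E}$. Bounded $\gamma$-variation: a countably additive vector measure $F:\Sigma\to X$ has bounded $\gamma$-variation with respect to $\mu$ if $\|F\|_{V_\gamma(\mu;X)}<\infty$, where $$\|F\|_{V_\gamma(\mu;X)}:=\sup\Big(\mathbb{E}\Big\|\sum_{n=1}^N\gamma_n\frac{F(A_n)}{\sqrt{\mu(A_n)}}\Big\|^2\Big)^{1/2},$$ the supremum being taken over all finite collections of disjoint sets $A_1,\dots,A_N\in\Sigma$ such that $\mu(A_n)>0$ for all $n=1,\dots,N$. $\gamma$-summing operators: for a Hilbert space $H$, a bounded operator $T:H\to X$ is $\gamma$-summing if there exists a constant $C$ such that for all finite orthonormal systems $\{h_1,\dots,h_N\}$ in $H$ one has $\mathbb{E}\|\sum_{n=1}^N\gamma_n Th_n\|^2\le C^2$. The least such constant $C$ is denoted $\|T\|_{\gamma_\infty(H,X)}$, and $\gamma_\infty(H,X)$ is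 the space of all $\gamma$-summing operators from $H$ to $X$.
   Formalization: Added hypothesis: F vanishes on μ-null sets, or μ takes arbitrarily small positive values; without it (1)⇒(2) fails, e.g. on {0,1} with μ=δ_0, F=δ_1. Scalars are real. *)

theory Defs
  imports "HOL-Probability.Probability"
begin

text \<open>All scalars are real: \<open>'x::banach\<close> is a real Banach space and \<open>L\<^sup>2(\<mu>)\<close> consists of
  real-valued functions.\<close>

definition gaussian_sequence :: "'w measure \<Rightarrow> (nat \<Rightarrow> 'w \<Rightarrow> real) \<Rightarrow> bool" where
  "gaussian_sequence P \<gamma> \<longleftrightarrow>
     prob_space P \<and>
     prob_space.indep_vars P (\<lambda>_. borel) \<gamma> {1..} \<and>
     (\<forall>n\<ge>1. distributed P lborel (\<gamma> n) std_normal_density)"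

text \<open>For a Gaussian sequence the integrand below is always integrable: it is a continuous function
  of \<open>\<gamma> 1, \<dots>, \<gamma> N\<close> dominated by a multiple of the sum of their squares. No second countability of
  \<open>'x\<close> is needed.\<close>

definition gaussian_sum_moment ::
  "'w measure \<Rightarrow> (nat \<Rightarrow> 'w \<Rightarrow> real) \<Rightarrow> nat \<Rightarrow> (nat \<Rightarrow> 'x::real_normed_vector) \<Rightarrow> real" where
  "gaussian_sum_moment P \<gamma> N x =
     (\<integral>\<omega>. (norm (\<Sum>n=1..N. \<gamma> n \<omega> *\<^sub>R x n))\<^sup>2 \<partial>P)"

text \<open>The case of a constant sequence of empty sets forces \<open>F {} = 0\<close>, so finite additivity is
  included. Values of \<open>F\<close> outside \<open>sets M\<close> are irrelevant.\<close>

definition vector_measure :: "'a measure \<Rightarrow> ('a set \<Rightarrow> 'x::real_normed_vector) \<Rightarrow> bool" where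
  "vector_measure M F \<longleftrightarrow>
     (\<forall>A :: nat \<Rightarrow> 'a set. range A \<subseteq> sets M \<longrightarrow> disjoint_family A \<longrightarrow>
        (\<lambda>n. F (A n)) sums F (\<Union>n. A n))"

definition gamma_variation ::
  "'w measure \<Rightarrow> (nat \<Rightarrow> 'w \<Rightarrow> real) \<Rightarrow> 'a measure \<Rightarrow> ('a set \<Rightarrow> 'x::real_normed_vector) \<Rightarrow> ennreal"
  where
  "gamma_variation P \<gamma> M F =
     Sup {ennreal (sqrt (gaussian_sum_moment P \<gamma> N (\<lambda>n. F (A n) /\<^sub>R sqrt (measure M (A n))))) |
            (N :: nat) (A :: nat \<Rightarrow> 'a set).
            (\<forall>n\<in>{1..N}. A n \<in> sets M \<and> measure M (A n) > 0) \<and>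
            disjoint_family_on A {1..N}}"

definition bounded_gamma_variation ::
  "'w measure \<Rightarrow> (nat \<Rightarrow> 'w \<Rightarrow> real) \<Rightarrow> 'a measure \<Rightarrow> ('a set \<Rightarrow> 'x::real_normed_vector) \<Rightarrow> bool"
  where
  "bounded_gamma_variation P \<gamma> M F \<longleftrightarrow> gamma_variation P \<gamma> M F < \<infinity>"

text \<open>Elements of \<open>L\<^sup>2(\<mu>)\<close> are represented by square integrable functions, without passing to
  classes modulo equality almost everywhere.\<close>

definition L2 :: "'a measure \<Rightarrow> ('a \<Rightarrow> real) set" where
  "L2 M = {f \<in> borel_measurable M. integrable M (\<lambda>x. (f x)\<^sup>2)}"

definition L2_inner :: "'a measure \<Rightarrow> ('a \<Rightarrow> real) \<Rightarrow> ('a \<Rightarrow> real) \<Rightarrow> real" where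
  "L2_inner M f g = (\<integral>x. f x * g x \<partial>M)"

definition L2_norm :: "'a measure \<Rightarrow> ('a \<Rightarrow> real) \<Rightarrow> real" where
  "L2_norm M f = sqrt (L2_inner M f f)"

definition L2_orthonormal :: "'a measure \<Rightarrow> nat \<Rightarrow> (nat \<Rightarrow> 'a \<Rightarrow> real) \<Rightarrow> bool" where
  "L2_orthonormal M N h \<longleftrightarrow>
     (\<forall>i\<in>{1..N}. h i \<in> L2 M) \<and>
     (\<forall>i\<in>{1..N}. \<forall>j\<in>{1..N}. L2_inner M (h i) (h j) = (if i = j then 1 else 0))"

text \<open>Linearity together with boundedness for the seminorm \<open>L2_norm M\<close> forces \<open>T f = T g\<close> whenever
  \<open>f\<close> and \<open>g\<close> agree almost everywhere, so these are exactly the bounded operators on the Hilbert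
  space of equivalence classes.\<close>

definition L2_bounded_operator ::
  "'a measure \<Rightarrow> (('a \<Rightarrow> real) \<Rightarrow> 'x::real_normed_vector) \<Rightarrow> bool" where
  "L2_bounded_operator M T \<longleftrightarrow>
     (\<forall>f\<in>L2 M. \<forall>g\<in>L2 M. T (\<lambda>x. f x + g x) = T f + T g) \<and>
     (\<forall>c. \<forall>f\<in>L2 M. T (\<lambda>x. c * f x) = c *\<^sub>R T f) \<and>
     (\<exists>K. \<forall>f\<in>L2 M. norm (T f) \<le> K * L2_norm M f)"

definition gamma_summing_bound ::
  "'w measure \<Rightarrow> (nat \<Rightarrow> 'w \<Rightarrow> real) \<Rightarrow> 'a measure \<Rightarrow>
     (('a \<Rightarrow> real) \<Rightarrow> 'x::real_normed_vector) \<Rightarrow> real \<Rightarrow> bool" where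
  "gamma_summing_bound P \<gamma> M T C \<longleftrightarrow>
     C \<ge> 0 \<and>
     (\<forall>N h. L2_orthonormal M N h \<longrightarrow> gaussian_sum_moment P \<gamma> N (\<lambda>n. T (h n)) \<le> C\<^sup>2)"

definition gamma_summing ::
  "'w measure \<Rightarrow> (nat \<Rightarrow> 'w \<Rightarrow> real) \<Rightarrow> 'a measure \<Rightarrow>
     (('a \<Rightarrow> real) \<Rightarrow> 'x::real_normed_vector) \<Rightarrow> bool" where
  "gamma_summing P \<gamma> M T \<longleftrightarrow>
     L2_bounded_operator M T \<and> (\<exists>C. gamma_summing_bound P \<gamma> M T C)"

definition gamma_summing_norm ::
  "'w measure \<Rightarrow> (nat \<Rightarrow> 'w \<Rightarrow> real) \<Rightarrow> 'a measure \<Rightarrow>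
     (('a \<Rightarrow> real) \<Rightarrow> 'x::real_normed_vector) \<Rightarrow> real" where
  "gamma_summing_norm P \<gamma> M T = Inf {C. gamma_summing_bound P \<gamma> M T C}"

text \<open>Bounded \<open>\<gamma>\<close>-variation alone does not force \<open>F\<close> to vanish on null sets: on \<open>{0, 1}\<close> with
  \<open>\<mu> = \<delta>\<^sub>0\<close> and \<open>F = \<delta>\<^sub>1\<close>, every admissible collection consists of at most one set, so the
  \<open>\<gamma>\<close>-variation is 1, but \<open>F {1} = 1\<close> while \<open>T 1\<^bsub>{1}\<^esub> = T 0 = 0\<close> for every operator \<open>T\<close>.
  This can only happen when the positive values of \<open>\<mu>\<close> are bounded away from zero. If both
  alternatives below fail, \<open>F\<close> has bounded \<open>\<gamma>\<close>-variation but is not represented by any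
  \<open>\<gamma>\<close>-summing operator.\<close>

definition vanishes_on_null_sets :: "'a measure \<Rightarrow> ('a set \<Rightarrow> 'x::zero) \<Rightarrow> bool" where
  "vanishes_on_null_sets M F \<longleftrightarrow> (\<forall>A\<in>null_sets M. F A = 0)"

definition has_arbitrarily_small_sets :: "'a measure \<Rightarrow> bool" where
  "has_arbitrarily_small_sets M \<longleftrightarrow> (\<forall>e>0. \<exists>B\<in>sets M. 0 < measure M B \<and> measure M B < e)"

end

theory Submission
  imports Defs
begin

text \<open>
  Decisive is a comparison principle: if the rows of a matrix \<open>c\<close> are orthonormal, the second moment of
  \<open>\<Sum>n. \<gamma> n y n\<close> with \<open>y n = \<Sum>j. c n j x j\<close> is at most that of \<open>\<Sum>j. \<gamma> j x j\<close>. By rotation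
  invariance of the Gaussian measure one row may be rotated onto a coordinate axis; conditioning on that
  coordinate leaves a smaller problem with an additional deterministic shift \<open>v\<close>, and coordinates left over at
  the end only increase the moment, by symmetry and convexity. Applied to the normalised indicators of a
  partition, this bounds the moments of every orthonormal system of simple functions by the
  \<open>\<gamma>\<close>-variation. A single normalised simple function then gives boundedness of \<open>1\<^sub>A \<mapsto> F A\<close>, hence the
  operator on \<open>L\<^sup>2\<close>, and Fatou's lemma extends the bound to all orthonormal systems.
\<close>

subsection \<open>Gaussian second moments\<close>

text \<open>One inequality is cheap: normalised indicators of disjoint sets are an orthonormal
  system, so every \<gamma>-summing bound of a representing operator dominates the variation. The
  substance is the converse, where systems built from partitions must control all orthonormal
  systems; this is what the comparison principle is for. Its proof does not complete the rows to an
  orthogonal matrix but uses only rotations of two coordinates, and these reduce to shears, hence to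
  translations of Lebesgue measure.

  Two obstacles shape the details. Since \<open>'x\<close> may be non-separable, sums of measurable
  \<open>'x\<close>-valued maps can fail to be measurable, so Gaussian sums are always handled as
  continuous functions of real coordinates. And a partition may contain null cells, which cannot be
  normalised; they are harmless only if \<open>F\<close> vanishes there. That is either assumed or
  derived from the estimate of \<open>F B\<close> by the square root of the measure of
  \<open>B\<close>, applied to small sets \<open>B\<close>.\<close>

abbreviation std_normal :: "real measure" where
  "std_normal \<equiv> density lborel std_normal_density"

text \<open>Measurability is obtained by factoring through the coordinates: a measurable map into
  \<open>nat \<Rightarrow> real\<close> followed by a continuous real function.
  \<open>sets_PiM_equal_borel\<close> identifies the product sigma-algebra with the Borel one, so no
  measurability of an \<open>'x\<close>-valued sum is involved.\<close>

lemma borel_measurable_norm_sum_scaleR: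
  fixes x :: "nat \<Rightarrow> 'x::real_normed_vector" and v :: 'x
  assumes f: "\<And>i. i \<in> I \<Longrightarrow> f i \<in> borel_measurable M"
  shows "(\<lambda>\<omega>. norm (v + (\<Sum>i\<in>I. f i \<omega> *\<^sub>R x i))) \<in> borel_measurable M"
proof -
  \<comment> \<open>Padding by 0 makes all coordinates measurable, although \<open>f\<close> is
    controlled only on \<open>I\<close>.\<close>
  define g where "g = (\<lambda>\<omega> i. if i \<in> I then f i \<omega> else 0)"
  have "g \<in> measurable M (Pi\<^sub>M UNIV (\<lambda>i. borel))"
  proof (rule measurable_PiM_single')
    show "(\<lambda>\<omega>. g \<omega> i) \<in> borel_measurable M" for i
      using f by (cases "i \<in> I") (simp_all add: g_def)
  qed simp
  then have g: "g \<in> borel_measurable M"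
    using sets_PiM_equal_borel measurable_cong_sets by blast
  have "continuous_on UNIV (\<lambda>t::nat \<Rightarrow> real. norm (v + (\<Sum>i\<in>I. t i *\<^sub>R x i)))"
    by (intro continuous_intros continuous_on_product_coordinates)
  then have h: "(\<lambda>t::nat \<Rightarrow> real. norm (v + (\<Sum>i\<in>I. t i *\<^sub>R x i))) \<in> borel_measurable borel"
    by (rule borel_measurable_continuous_onI)
  have "(\<lambda>\<omega>. norm (v + (\<Sum>i\<in>I. f i \<omega> *\<^sub>R x i))) =
      (\<lambda>\<omega>. norm (v + (\<Sum>i\<in>I. g \<omega> i *\<^sub>R x i)))"
    by (auto simp: g_def intro!: ext arg_cong[of _ _ norm] sum.cong)
  then show ?thesis using measurable_compose[OF g h] by simp
qed

interpretation std_normal: prob_space std_normal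
  by (rule prob_space_normal_density) simp

interpretation std_normal_PiM: product_sigma_finite "\<lambda>_::nat. std_normal" ..

text \<open>The shift \<open>v\<close> holds the contribution of coordinates already conditioned on;
  \<open>gauss_moment_insert\<close> moves one coordinate into it. Values in \<open>ennreal\<close>
  let Fubini and monotonicity apply without integrability conditions.\<close>

definition gauss_moment :: "nat set \<Rightarrow> (nat \<Rightarrow> 'x::real_normed_vector) \<Rightarrow> 'x \<Rightarrow> ennreal" where
  "gauss_moment I x v =
     (\<integral>\<^sup>+t. ennreal ((norm (v + (\<Sum>i\<in>I. t i *\<^sub>R x i)))\<^sup>2) \<partial>Pi\<^sub>M I (\<lambda>_. std_normal))"

lemma gauss_moment_cong:
  "(\<And>i. i \<in> I \<Longrightarrow> x i = y i) \<Longrightarrow> gauss_moment I x v = gauss_moment I y v"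
  by (simp add: gauss_moment_def cong: sum.cong)

lemma gauss_moment_empty [simp]: "gauss_moment {} x v = ennreal ((norm v)\<^sup>2)"
  unfolding gauss_moment_def by (subst std_normal_PiM.nn_integral_empty) auto

lemma measurable_gauss_moment_integrand:
  fixes I :: "nat set" and x :: "nat \<Rightarrow> 'x::real_normed_vector"
  shows "(\<lambda>t. ennreal ((norm (v + (\<Sum>i\<in>I. t i *\<^sub>R x i)))\<^sup>2)) \<in> borel_measurable (Pi\<^sub>M I (\<lambda>_. std_normal))"
proof -
  have "(\<lambda>t. norm (v + (\<Sum>i\<in>I. t i *\<^sub>R x i))) \<in> borel_measurable (Pi\<^sub>M I (\<lambda>_. std_normal))"
    by (rule borel_measurable_norm_sum_scaleR)
      (use measurable_component_singleton[of _ I "\<lambda>_. std_normal"] in simp)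
  then show ?thesis by measurable
qed

lemma gauss_moment_insert:
  assumes "finite I" "i \<notin> I"
  shows "gauss_moment (insert i I) x v = (\<integral>\<^sup>+s. gauss_moment I x (v + s *\<^sub>R x i) \<partial>std_normal)"
proof -
  have "gauss_moment (insert i I) x v = (\<integral>\<^sup>+s. \<integral>\<^sup>+t. ennreal ((norm (v + (\<Sum>j\<in>insert i I. (t(i := s)) j *\<^sub>R x j)))\<^sup>2)
      \<partial>Pi\<^sub>M I (\<lambda>_. std_normal) \<partial>std_normal)"
    unfolding gauss_moment_def
    by (rule std_normal_PiM.product_nn_integral_insert_rev[OF assms measurable_gauss_moment_integrand])
  also have "\<dots> = (\<integral>\<^sup>+s. gauss_moment I x (v + s *\<^sub>R x i) \<partial>std_normal)"
    unfolding gauss_moment_def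
  proof (intro nn_integral_cong)
    fix s :: real and t :: "nat \<Rightarrow> real"
    have "(\<Sum>j\<in>I. (t(i := s)) j *\<^sub>R x j) = (\<Sum>j\<in>I. t j *\<^sub>R x j)"
      by (rule sum.cong) (use assms in auto)
    then show "ennreal ((norm (v + (\<Sum>j\<in>insert i I. (t(i := s)) j *\<^sub>R x j)))\<^sup>2) =
        ennreal ((norm (v + s *\<^sub>R x i + (\<Sum>i\<in>I. t i *\<^sub>R x i)))\<^sup>2)"
      using assms by (simp add: add_ac)
  qed
  finally show ?thesis .
qed

text \<open>Joint measurability in two coefficients of the shift, as required for rotating two
  coordinates under an iterated integral. The coefficients \<open>a\<close> and \<open>b\<close> are
  treated as two additional coordinates with fresh indices \<open>k\<close> and \<open>l\<close>,
  attached to the vectors \<open>y\<close> and \<open>z\<close>; then only \<open>t\<close> is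
  integrated out.\<close>

lemma measurable_gauss_moment_pair:
  assumes "finite I"
  shows "(\<lambda>(a, b). gauss_moment I x (v + a *\<^sub>R y + b *\<^sub>R z)) \<in> borel_measurable (borel \<Otimes>\<^sub>M borel)"
proof -
  interpret finite_product_sigma_finite "\<lambda>_::nat. std_normal" I by standard fact
  interpret PI: sigma_finite_measure "Pi\<^sub>M I (\<lambda>_. std_normal)"
    by (rule std_normal_PiM.sigma_finite) fact
  obtain k :: nat where k: "k \<notin> I" using assms by (metis finite_nat_set_iff_bounded less_irrefl)
  obtain l :: nat where l: "l \<notin> insert k I" using assms
    by (metis finite_nat_set_iff_bounded less_irrefl finite_insert)
  define f where "f i p = (if i = k then fst (fst p) else if i = l then snd (fst p) else snd p i)"
    for i and p :: "(real \<times> real) \<times> (nat \<Rightarrow> real)"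
  have "(\<lambda>p. norm (v + (\<Sum>i\<in>insert l (insert k I). f i p *\<^sub>R (x(k := y, l := z)) i)))
      \<in> borel_measurable ((borel \<Otimes>\<^sub>M borel) \<Otimes>\<^sub>M Pi\<^sub>M I (\<lambda>_. std_normal))"
  proof (rule borel_measurable_norm_sum_scaleR)
    fix i assume "i \<in> insert l (insert k I)"
    have [measurable]: "(\<lambda>p. snd p i) \<in> borel_measurable ((borel \<Otimes>\<^sub>M borel) \<Otimes>\<^sub>M Pi\<^sub>M I (\<lambda>_. std_normal))"
      if "i \<in> I"
      using measurable_compose[OF measurable_snd measurable_component_singleton[OF that, of "\<lambda>_. std_normal"]]
      by simp
    show "f i \<in> borel_measurable ((borel \<Otimes>\<^sub>M borel) \<Otimes>\<^sub>M Pi\<^sub>M I (\<lambda>_. std_normal))"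
      using \<open>i \<in> _\<close> unfolding f_def by (cases "i = k"; cases "i = l") auto
  qed
  moreover have "(\<Sum>i\<in>insert l (insert k I). f i p *\<^sub>R (x(k := y, l := z)) i) =
      fst (fst p) *\<^sub>R y + snd (fst p) *\<^sub>R z + (\<Sum>i\<in>I. snd p i *\<^sub>R x i)" for p
  proof -
    have "(\<Sum>i\<in>I. f i p *\<^sub>R (x(k := y, l := z)) i) = (\<Sum>i\<in>I. snd p i *\<^sub>R x i)"
      by (rule sum.cong) (use k l in \<open>auto simp: f_def\<close>)
    then show ?thesis using k l assms by (simp add: f_def)
  qed
  ultimately have "(\<lambda>p. norm (v + fst (fst p) *\<^sub>R y + snd (fst p) *\<^sub>R z + (\<Sum>i\<in>I. snd p i *\<^sub>R x i)))
      \<in> borel_measurable ((borel \<Otimes>\<^sub>M borel) \<Otimes>\<^sub>M Pi\<^sub>M I (\<lambda>_. std_normal))"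
    by (simp add: add.assoc)
  then have [measurable]: "(\<lambda>(q, t). norm (v + fst q *\<^sub>R y + snd q *\<^sub>R z + (\<Sum>i\<in>I. t i *\<^sub>R x i)))
      \<in> borel_measurable ((borel \<Otimes>\<^sub>M borel) \<Otimes>\<^sub>M Pi\<^sub>M I (\<lambda>_. std_normal))"
    by (simp add: case_prod_beta')
  show ?thesis
    unfolding gauss_moment_def case_prod_beta' by measurable
qed

lemma measurable_gauss_moment_line:
  assumes "finite I"
  shows "(\<lambda>s. gauss_moment I x (v + s *\<^sub>R y)) \<in> borel_measurable borel"
proof -
  have "(\<lambda>s::real. (s, 0::real)) \<in> borel \<rightarrow>\<^sub>M borel \<Otimes>\<^sub>M borel" by measurable
  from measurable_compose[OF this measurable_gauss_moment_pair[OF assms, of x v y 0]]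
  show ?thesis by simp
qed

section \<open>Symmetry and convexity: additional coordinates increase the moment\<close>

lemma nn_integral_std_normal_uminus:
  assumes [measurable]: "f \<in> borel_measurable borel"
  shows "(\<integral>\<^sup>+s. f (- s) \<partial>std_normal) = (\<integral>\<^sup>+s. f s \<partial>std_normal)"
proof -
  have "(\<integral>\<^sup>+s. f s \<partial>std_normal) = (\<integral>\<^sup>+s. std_normal_density s * f s \<partial>lborel)"
    by (simp add: nn_integral_density)
  also have "\<dots> = (\<integral>\<^sup>+s. std_normal_density (- s) * f (- s) \<partial>lborel)"
    by (subst nn_integral_real_affine[where c="-1" and t=0]) auto
  also have "\<dots> = (\<integral>\<^sup>+s. f (- s) \<partial>std_normal)"
    by (simp add: nn_integral_density std_normal_density_def)
  finally show ?thesis ..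
qed

lemma norm_square_midpoint:
  fixes w u :: "'x::real_normed_vector"
  shows "2 * (norm w)\<^sup>2 \<le> (norm (w + u))\<^sup>2 + (norm (w - u))\<^sup>2"
proof -
  have "norm (2 *\<^sub>R w) \<le> norm (w + u) + norm (w - u)"
    using norm_triangle_ineq[of "w + u" "w - u"] by (simp add: scaleR_2)
  then have "(2 * norm w)\<^sup>2 \<le> (norm (w + u) + norm (w - u))\<^sup>2"
    by (intro power_mono) auto
  also have "\<dots> \<le> 2 * ((norm (w + u))\<^sup>2 + (norm (w - u))\<^sup>2)"
    using sum_squares_ge_zero[of "norm (w + u) - norm (w - u)" 0]
    by (simp add: power2_eq_square algebra_simps)
  finally show ?thesis by (simp add: power_mult_distrib)
qed

lemma gauss_moment_midpoint:
  "2 * gauss_moment I x v \<le> gauss_moment I x (v + u) + gauss_moment I x (v - u)"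
proof -
  have "2 * gauss_moment I x v =
     (\<integral>\<^sup>+t. 2 * ennreal ((norm (v + (\<Sum>i\<in>I. t i *\<^sub>R x i)))\<^sup>2) \<partial>Pi\<^sub>M I (\<lambda>_. std_normal))"
    unfolding gauss_moment_def by (rule nn_integral_cmult[symmetric, OF measurable_gauss_moment_integrand])
  also have "\<dots> \<le> (\<integral>\<^sup>+t. ennreal ((norm (v + u + (\<Sum>i\<in>I. t i *\<^sub>R x i)))\<^sup>2) +
      ennreal ((norm (v - u + (\<Sum>i\<in>I. t i *\<^sub>R x i)))\<^sup>2) \<partial>Pi\<^sub>M I (\<lambda>_. std_normal))"
  proof (rule nn_integral_mono)
    fix t :: "nat \<Rightarrow> real"
    let ?s = "\<Sum>i\<in>I. t i *\<^sub>R x i"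
    have "2 * (norm (v + ?s))\<^sup>2 \<le> (norm (v + u + ?s))\<^sup>2 + (norm (v - u + ?s))\<^sup>2"
      using norm_square_midpoint[of "v + ?s" u] by (simp add: algebra_simps)
    then have "ennreal (2 * (norm (v + ?s))\<^sup>2) \<le> ennreal ((norm (v + u + ?s))\<^sup>2 + (norm (v - u + ?s))\<^sup>2)"
      by (rule ennreal_leI)
    then show "2 * ennreal ((norm (v + ?s))\<^sup>2) \<le> ennreal ((norm (v + u + ?s))\<^sup>2) + ennreal ((norm (v - u + ?s))\<^sup>2)"
      by (simp add: ennreal_mult)
  qed
  also have "\<dots> = gauss_moment I x (v + u) + gauss_moment I x (v - u)"
    unfolding gauss_moment_def
    by (rule nn_integral_add) (rule measurable_gauss_moment_integrand)+
  finally show ?thesis .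
qed

text \<open>Jensen's inequality for the new coordinate, by pairing \<open>s\<close> with
  \<open>- s\<close>: midpoint convexity bounds the value at \<open>v\<close> by the mean of the
  values at the two opposite shifts, and by symmetry both have the same integral.\<close>

lemma gauss_moment_insert_mono:
  assumes "finite I" "i \<notin> I"
  shows "gauss_moment I x v \<le> gauss_moment (insert i I) x v"
proof -
  let ?g = "\<lambda>s. gauss_moment I x (v + s *\<^sub>R x i)"
  have [measurable]: "?g \<in> borel_measurable borel"
    by (rule measurable_gauss_moment_line[OF assms(1)])
  have [measurable]: "(\<lambda>s. ?g (- s)) \<in> borel_measurable borel"
    using measurable_gauss_moment_line[OF assms(1), of x v "- x i"] by simp
  have "2 * gauss_moment I x v = (\<integral>\<^sup>+s. 2 * gauss_moment I x v \<partial>std_normal)"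
    using std_normal.emeasure_space_1 by (simp only: nn_integral_const mult_1_right)
  also have "\<dots> \<le> (\<integral>\<^sup>+s. ?g s + ?g (- s) \<partial>std_normal)"
    using gauss_moment_midpoint by (intro nn_integral_mono) simp
  also have "\<dots> = (\<integral>\<^sup>+s. ?g s \<partial>std_normal) + (\<integral>\<^sup>+s. ?g (- s) \<partial>std_normal)"
    by (rule nn_integral_add) measurable
  also have "\<dots> = 2 * (\<integral>\<^sup>+s. ?g s \<partial>std_normal)"
    by (subst nn_integral_std_normal_uminus) (auto simp: mult_2)
  finally show ?thesis
    by (simp add: gauss_moment_insert[OF assms] ennreal_mult_le_mult_iff)
qed

lemma gauss_moment_empty_le:
  assumes "finite J"
  shows "ennreal ((norm v)\<^sup>2) \<le> gauss_moment J x v"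
  using assms
proof (induction J rule: finite_induct)
  case (insert i J)
  then show ?case using gauss_moment_insert_mono[of J i x v] by (metis order_trans)
qed simp

section \<open>Rotation invariance of the planar Gaussian measure\<close>

lemma nn_integral_lborel_pair_shear:
  fixes t :: real
  assumes [measurable]: "g \<in> borel_measurable (borel \<Otimes>\<^sub>M borel)"
  shows "(\<integral>\<^sup>+b. \<integral>\<^sup>+a. g (a + t * b, b) \<partial>lborel \<partial>lborel) = (\<integral>\<^sup>+b. \<integral>\<^sup>+a. g (a, b) \<partial>lborel \<partial>lborel)"
proof (rule nn_integral_cong)
  fix b :: real
  have "(\<integral>\<^sup>+a. g (a, b) \<partial>lborel) = (\<integral>\<^sup>+a. g (t * b + 1 * a, b) \<partial>lborel)"
    by (subst nn_integral_real_affine[where c=1 and t="t * b"]) auto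
  then show "(\<integral>\<^sup>+a. g (a + t * b, b) \<partial>lborel) = (\<integral>\<^sup>+a. g (a, b) \<partial>lborel)"
    by (simp add: add.commute)
qed

lemma nn_integral_lborel_swap:
  fixes g :: "real \<times> real \<Rightarrow> ennreal"
  assumes [measurable]: "g \<in> borel_measurable (borel \<Otimes>\<^sub>M borel)"
  shows "(\<integral>\<^sup>+b. \<integral>\<^sup>+a. g (a, b) \<partial>lborel \<partial>lborel) = (\<integral>\<^sup>+a. \<integral>\<^sup>+b. g (a, b) \<partial>lborel \<partial>lborel)"
  by (rule lborel_pair.Fubini') measurable

text \<open>A rotation with cosine \<open>c\<close> and sine \<open>s\<close> is a product of three
  shears with parameters \<open>t\<close>, \<open>- s\<close>, \<open>t\<close>, alternating between
  the two variables. Each shear is a translation in one variable while the other is fixed, so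
  Lebesgue measure is preserved.\<close>

lemma nn_integral_lborel_pair_rotation:
  fixes c s :: real
  assumes g: "g \<in> borel_measurable (borel \<Otimes>\<^sub>M borel)" and cs: "c\<^sup>2 + s\<^sup>2 = 1" "c \<noteq> -1"
  shows "(\<integral>\<^sup>+b. \<integral>\<^sup>+a. g (c * a + s * b, c * b - s * a) \<partial>lborel \<partial>lborel) =
    (\<integral>\<^sup>+b. \<integral>\<^sup>+a. g (a, b) \<partial>lborel \<partial>lborel)"
proof -
  note g [measurable]
  \<comment> \<open>This is the tangent of half the angle, whence the exclusion of
    \<open>c = -1\<close>. The relations \<open>t * (1 + c) = s\<close> and
    \<open>t * s = 1 - c\<close> are exactly what the factorisation into shears uses.\<close>
  define t where "t = s / (1 + c)"
  have t: "t * (1 + c) = s" using cs by (simp add: t_def)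
  have "t * s * (1 + c) = (1 - c) * (1 + c)"
    using t cs(1) by (simp add: power2_eq_square algebra_simps)
  then have ts: "t * s = 1 - c" using cs by simp
  define h where "h = (\<lambda>(a, b). g (a + t * b, b))"
  define k where "k = (\<lambda>(a, b). h (a, b - s * a))"
  have [measurable]: "h \<in> borel_measurable (borel \<Otimes>\<^sub>M borel)" unfolding h_def by measurable
  have [measurable]: "k \<in> borel_measurable (borel \<Otimes>\<^sub>M borel)" unfolding k_def by measurable
  have "g (c * a + s * b, c * b - s * a) = k (a + t * b, b)" for a b
  proof -
    have "b - s * (a + t * b) = (1 - t * s) * b - s * a" by (simp add: algebra_simps)
    then have 1: "b - s * (a + t * b) = c * b - s * a" by (simp add: ts)
    have "a + t * b + t * (c * b - s * a) = (1 - t * s) * a + t * (1 + c) * b" by (simp add: algebra_simps)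
    then have "a + t * b + t * (c * b - s * a) = c * a + s * b" by (simp add: ts t)
    with 1 show ?thesis by (simp add: k_def h_def)
  qed
  then have "(\<integral>\<^sup>+b. \<integral>\<^sup>+a. g (c * a + s * b, c * b - s * a) \<partial>lborel \<partial>lborel) =
      (\<integral>\<^sup>+b. \<integral>\<^sup>+a. k (a + t * b, b) \<partial>lborel \<partial>lborel)" by simp
  also have "\<dots> = (\<integral>\<^sup>+b. \<integral>\<^sup>+a. k (a, b) \<partial>lborel \<partial>lborel)"
    by (rule nn_integral_lborel_pair_shear) measurable
  \<comment> \<open>Exchanging the integrals puts the second variable inside, so that the middle
    shear becomes a translation of the inner integral as well.\<close>
  also have "\<dots> = (\<integral>\<^sup>+a. \<integral>\<^sup>+b. h (a, b - s * a) \<partial>lborel \<partial>lborel)"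
    by (subst nn_integral_lborel_swap) (auto simp: k_def)
  also have "\<dots> = (\<integral>\<^sup>+a. \<integral>\<^sup>+b. h (a, b) \<partial>lborel \<partial>lborel)"
    using nn_integral_lborel_pair_shear[of "\<lambda>(b, a). h (a, b)" "- s"] by simp
  also have "\<dots> = (\<integral>\<^sup>+b. \<integral>\<^sup>+a. g (a + t * b, b) \<partial>lborel \<partial>lborel)"
    by (subst nn_integral_lborel_swap[symmetric]) (auto simp: h_def)
  also have "\<dots> = (\<integral>\<^sup>+b. \<integral>\<^sup>+a. g (a, b) \<partial>lborel \<partial>lborel)"
    by (rule nn_integral_lborel_pair_shear) measurable
  finally show ?thesis .
qed

lemma std_normal_density_mult_rotation:
  fixes c s :: real
  assumes "c\<^sup>2 + s\<^sup>2 = 1"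
  shows "std_normal_density (c * a + s * b) * std_normal_density (c * b - s * a) =
    std_normal_density a * std_normal_density b"
proof -
  have "(c * a + s * b)\<^sup>2 + (c * b - s * a)\<^sup>2 = (c\<^sup>2 + s\<^sup>2) * (a\<^sup>2 + b\<^sup>2)"
    by (simp add: power2_eq_square algebra_simps)
  then have "- (c * a + s * b)\<^sup>2 / 2 + - (c * b - s * a)\<^sup>2 / 2 = - a\<^sup>2 / 2 + - b\<^sup>2 / 2"
    using assms by simp
  then have "exp (- (c * a + s * b)\<^sup>2 / 2) * exp (- (c * b - s * a)\<^sup>2 / 2) = exp (- a\<^sup>2 / 2) * exp (- b\<^sup>2 / 2)"
    by (simp only: exp_add[symmetric])
  then show ?thesis by (simp add: std_normal_density_def)
qed

lemma nn_integral_std_normal_pair: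
  assumes [measurable]: "f \<in> borel_measurable (borel \<Otimes>\<^sub>M borel)"
  shows "(\<integral>\<^sup>+b. \<integral>\<^sup>+a. f (a, b) \<partial>std_normal \<partial>std_normal) =
    (\<integral>\<^sup>+b. \<integral>\<^sup>+a. ennreal (std_normal_density a * std_normal_density b) * f (a, b) \<partial>lborel \<partial>lborel)"
proof -
  have "(\<integral>\<^sup>+b. \<integral>\<^sup>+a. f (a, b) \<partial>std_normal \<partial>std_normal) =
      (\<integral>\<^sup>+b. ennreal (std_normal_density b) * (\<integral>\<^sup>+a. ennreal (std_normal_density a) * f (a, b) \<partial>lborel) \<partial>lborel)"
    by (simp add: nn_integral_density)
  also have "\<dots> = (\<integral>\<^sup>+b. \<integral>\<^sup>+a. ennreal (std_normal_density b) * (ennreal (std_normal_density a) * f (a, b)) \<partial>lborel \<partial>lborel)"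
    by (subst nn_integral_cmult) auto
  finally show ?thesis by (simp add: ennreal_mult mult_ac)
qed

lemma nn_integral_std_normal_pair_rotation:
  fixes c s :: real
  assumes f: "f \<in> borel_measurable (borel \<Otimes>\<^sub>M borel)" and cs: "c\<^sup>2 + s\<^sup>2 = 1" "c \<noteq> -1"
  shows "(\<integral>\<^sup>+b. \<integral>\<^sup>+a. f (c * a + s * b, c * b - s * a) \<partial>std_normal \<partial>std_normal) =
    (\<integral>\<^sup>+b. \<integral>\<^sup>+a. f (a, b) \<partial>std_normal \<partial>std_normal)"
proof -
  note f [measurable]
  let ?g = "\<lambda>(a, b). ennreal (std_normal_density a * std_normal_density b) * f (a, b)"
  have "(\<integral>\<^sup>+b. \<integral>\<^sup>+a. f (c * a + s * b, c * b - s * a) \<partial>std_normal \<partial>std_normal) =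
     (\<integral>\<^sup>+b. \<integral>\<^sup>+a. ?g (c * a + s * b, c * b - s * a) \<partial>lborel \<partial>lborel)"
    using nn_integral_std_normal_pair[of "\<lambda>(a, b). f (c * a + s * b, c * b - s * a)"]
    by (simp add: std_normal_density_mult_rotation[OF cs(1)])
  also have "\<dots> = (\<integral>\<^sup>+b. \<integral>\<^sup>+a. ?g (a, b) \<partial>lborel \<partial>lborel)"
    by (rule nn_integral_lborel_pair_rotation) (use cs in auto)
  also have "\<dots> = (\<integral>\<^sup>+b. \<integral>\<^sup>+a. f (a, b) \<partial>std_normal \<partial>std_normal)"
    by (simp add: nn_integral_std_normal_pair)
  finally show ?thesis .
qed

text \<open>With the other coordinates absorbed into a moment over \<open>K\<close>, rotating the
  vectors \<open>x i\<close> and \<open>x j\<close> is the same as rotating their two Gaussian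
  coefficients, and the planar invariance applies.\<close>

lemma gauss_moment_rotation:
  fixes c s :: real
  assumes J: "finite J" "i \<in> J" "j \<in> J" "i \<noteq> j" and cs: "c\<^sup>2 + s\<^sup>2 = 1" "c \<noteq> -1"
  shows "gauss_moment J (x(i := c *\<^sub>R x i + s *\<^sub>R x j, j := c *\<^sub>R x j - s *\<^sub>R x i)) v = gauss_moment J x v"
proof -
  define K where "K = J - {i, j}"
  have K: "finite K" "i \<notin> insert j K" "j \<notin> K" "J = insert i (insert j K)"
    using J by (auto simp: K_def)
  have two: "gauss_moment J y v = (\<integral>\<^sup>+b. \<integral>\<^sup>+a. gauss_moment K y (v + b *\<^sub>R y i + a *\<^sub>R y j) \<partial>std_normal \<partial>std_normal)" for y
    unfolding K(4) using K by (simp add: gauss_moment_insert)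
  let ?f = "\<lambda>(a, b). gauss_moment K x (v + a *\<^sub>R x j + b *\<^sub>R x i)"
  let ?y = "x(i := c *\<^sub>R x i + s *\<^sub>R x j, j := c *\<^sub>R x j - s *\<^sub>R x i)"
  have "gauss_moment J ?y v = (\<integral>\<^sup>+b. \<integral>\<^sup>+a. gauss_moment K x (v + b *\<^sub>R ?y i + a *\<^sub>R ?y j) \<partial>std_normal \<partial>std_normal)"
    unfolding two by (intro nn_integral_cong gauss_moment_cong) (use K in auto)
  \<comment> \<open>Collecting terms: \<open>a\<close> belongs to index \<open>j\<close> and
    \<open>b\<close> to index \<open>i\<close>, so the new coefficient of \<open>x j\<close> is
    \<open>c * a + s * b\<close> and that of \<open>x i\<close> is
    \<open>c * b - s * a\<close>.\<close>
  also have "\<dots> = (\<integral>\<^sup>+b. \<integral>\<^sup>+a. ?f (c * a + s * b, c * b - s * a) \<partial>std_normal \<partial>std_normal)"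
    using J by (simp add: algebra_simps)
  also have "\<dots> = (\<integral>\<^sup>+b. \<integral>\<^sup>+a. ?f (a, b) \<partial>std_normal \<partial>std_normal)"
    by (rule nn_integral_std_normal_pair_rotation[OF measurable_gauss_moment_pair[OF K(1)] cs])
  also have "\<dots> = gauss_moment J x v"
    by (simp add: two add_ac)
  finally show ?thesis .
qed

section \<open>The comparison principle for orthonormal rows\<close>

lemma sum_mult_rotation:
  fixes c s :: real and a :: "nat \<Rightarrow> real" and x :: "nat \<Rightarrow> 'x::real_vector"
  assumes J: "finite J" "i \<in> J" "j \<in> J" "i \<noteq> j" and cs: "c\<^sup>2 + s\<^sup>2 = 1"
  shows "(\<Sum>k\<in>J. (a(i := c * a i + s * a j, j := c * a j - s * a i)) k *\<^sub>R
      (x(i := c *\<^sub>R x i + s *\<^sub>R x j, j := c *\<^sub>R x j - s *\<^sub>R x i)) k) = (\<Sum>k\<in>J. a k *\<^sub>R x k)"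
    (is "(\<Sum>k\<in>J. ?a k *\<^sub>R ?x k) = _")
proof -
  define K where "K = J - {i, j}"
  have K: "finite K" "i \<notin> insert j K" "j \<notin> K" "J = insert i (insert j K)"
    using J by (auto simp: K_def)
  have "(\<Sum>k\<in>K. ?a k *\<^sub>R ?x k) = (\<Sum>k\<in>K. a k *\<^sub>R x k)"
    by (rule sum.cong) (use K in auto)
  moreover have "(c * a i + s * a j) *\<^sub>R (c *\<^sub>R x i + s *\<^sub>R x j) + (c * a j - s * a i) *\<^sub>R (c *\<^sub>R x j - s *\<^sub>R x i)
      = (c\<^sup>2 + s\<^sup>2) *\<^sub>R (a i *\<^sub>R x i) + (c\<^sup>2 + s\<^sup>2) *\<^sub>R (a j *\<^sub>R x j)"
    by (simp add: power2_eq_square algebra_simps)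
  ultimately show ?thesis using K J(4) cs by simp
qed

text \<open>Successive plane rotations eliminate all but one of the entries of the unit row \<open>c m\<close>.\<close>

lemma rotate_row_to_unit_vector:
  fixes c :: "nat \<Rightarrow> nat \<Rightarrow> real" and x :: "nat \<Rightarrow> 'x::real_normed_vector"
  assumes "finite J" and "(\<Sum>j\<in>J. c m j * c m j) = 1"
  shows "\<exists>d y p. p \<in> J \<and> (\<forall>j\<in>J. j \<noteq> p \<longrightarrow> d m j = 0) \<and>
    (\<forall>n l. (\<Sum>j\<in>J. d n j * d l j) = (\<Sum>j\<in>J. c n j * c l j)) \<and>
    (\<forall>n. (\<Sum>j\<in>J. d n j *\<^sub>R y j) = (\<Sum>j\<in>J. c n j *\<^sub>R x j)) \<and>
    (\<forall>v. gauss_moment J y v = gauss_moment J x v)"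
  using assms(2)
\<comment> \<open>The measure is the number of nonzero entries of row \<open>m\<close>; each
  rotation kills one entry and creates none, since both entries it touches were nonzero.\<close>
proof (induction "card {j\<in>J. c m j \<noteq> 0}" arbitrary: c x rule: less_induct)
  case less
  have "\<exists>p\<in>J. c m p \<noteq> 0"
    using less.prems by (metis (no_types, lifting) mult_zero_left sum.neutral zero_neq_one)
  then obtain p where p: "p \<in> J" "c m p \<noteq> 0" by blast
  show ?case
  proof (cases "\<forall>j\<in>J. j \<noteq> p \<longrightarrow> c m j = 0")
    case True
    then show ?thesis using p by blast
  next
    case False
    then obtain q where q: "q \<in> J" "q \<noteq> p" "c m q \<noteq> 0" by blast
    define r where "r = sqrt ((c m p)\<^sup>2 + (c m q)\<^sup>2)"
    have r: "r > 0" unfolding r_def using p by (simp add: add_pos_nonneg)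
    have r2: "r\<^sup>2 = (c m p)\<^sup>2 + (c m q)\<^sup>2" unfolding r_def by simp
    \<comment> \<open>Cosine and sine are chosen so that the new entry at \<open>q\<close>, which is
      \<open>C * c m q - S * c m p\<close>, vanishes.\<close>
    define C where "C = c m p / r"
    define S where "S = c m q / r"
    have cs: "C\<^sup>2 + S\<^sup>2 = 1"
      unfolding C_def S_def power_divide add_divide_distrib[symmetric] r2[symmetric] using r by simp
    \<comment> \<open>Rotating only with a nonzero entry at \<open>q\<close> keeps the angle away
      from the one excluded in \<open>gauss_moment_rotation\<close>.\<close>
    have "S \<noteq> 0" using q r by (simp add: S_def)
    then have cm1: "C \<noteq> -1" using cs by auto
    \<comment> \<open>All rows and the vectors undergo the same rotation, so Gram matrix and linear
      combinations are preserved simultaneously.\<close>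
    define d where "d = (\<lambda>n. (c n)(p := C * c n p + S * c n q, q := C * c n q - S * c n p))"
    define y where "y = x(p := C *\<^sub>R x p + S *\<^sub>R x q, q := C *\<^sub>R x q - S *\<^sub>R x p)"
    have dq: "d m q = 0" using q by (simp add: d_def C_def S_def)
    have sub: "{j\<in>J. d m j \<noteq> 0} \<subset> {j\<in>J. c m j \<noteq> 0}"
    proof -
      have "{j\<in>J. d m j \<noteq> 0} \<subseteq> {j\<in>J. c m j \<noteq> 0}"
        using p dq by (auto simp: d_def split: if_splits)
      moreover have "q \<notin> {j\<in>J. d m j \<noteq> 0}" "q \<in> {j\<in>J. c m j \<noteq> 0}" using dq q by auto
      ultimately show ?thesis by blast
    qed
    then have less_card: "card {j\<in>J. d m j \<noteq> 0} < card {j\<in>J. c m j \<noteq> 0}"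
      using assms(1) by (intro psubset_card_mono) auto
    \<comment> \<open>Here the rotation identity is used with real numbers as vectors: the row
      \<open>c l\<close> takes the place of \<open>x\<close>.\<close>
    have gram: "(\<Sum>j\<in>J. d n j * d l j) = (\<Sum>j\<in>J. c n j * c l j)" for n l
      using sum_mult_rotation[of J p q C S "c n" "c l"] assms(1) p q cs
      unfolding d_def by simp
    have comb: "(\<Sum>j\<in>J. d n j *\<^sub>R y j) = (\<Sum>j\<in>J. c n j *\<^sub>R x j)" for n
      unfolding d_def y_def by (rule sum_mult_rotation) (use assms(1) p q cs in auto)
    have mom: "gauss_moment J y v = gauss_moment J x v" for v
      unfolding y_def by (rule gauss_moment_rotation) (use assms(1) p q cs cm1 in auto)
    have "(\<Sum>j\<in>J. d m j * d m j) = 1" using gram less.prems by simp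
    from less.hyps[of d, OF less_card this, of y] show ?thesis
      by (simp only: gram comb mom)
  qed
qed

text \<open>Once row \<open>m\<close> is a signed unit vector at \<open>p\<close>, orthogonality
  makes column \<open>p\<close> vanish in every other row. Coordinate \<open>m\<close> on the left
  and coordinate \<open>p\<close> on the right then produce the same random shift up to sign, and
  the remaining rows live on \<open>J - {p}\<close>. The shift must therefore be arbitrary in the
  induction.\<close>

lemma gauss_moment_orthonormal_le:
  fixes c :: "nat \<Rightarrow> nat \<Rightarrow> real" and x :: "nat \<Rightarrow> 'x::real_normed_vector"
  assumes "finite N" "finite J"
    and "\<And>n m. n \<in> N \<Longrightarrow> m \<in> N \<Longrightarrow> (\<Sum>j\<in>J. c n j * c m j) = (if n = m then 1 else 0)"
  shows "gauss_moment N (\<lambda>n. \<Sum>j\<in>J. c n j *\<^sub>R x j) v \<le> gauss_moment J x v"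
  using assms
proof (induction N arbitrary: c x v J rule: finite_induct)
  case empty
  then show ?case by (simp add: gauss_moment_empty_le)
next
  case (insert m N)
  have "(\<Sum>j\<in>J. c m j * c m j) = 1" using insert.prems by simp
  from rotate_row_to_unit_vector[OF insert.prems(1), of c m, OF this, of x]
  obtain d y p where p: "p \<in> J" and dm: "\<And>j. j \<in> J \<Longrightarrow> j \<noteq> p \<Longrightarrow> d m j = 0"
    and gram: "\<And>n l. (\<Sum>j\<in>J. d n j * d l j) = (\<Sum>j\<in>J. c n j * c l j)"
    and comb: "\<And>n. (\<Sum>j\<in>J. d n j *\<^sub>R y j) = (\<Sum>j\<in>J. c n j *\<^sub>R x j)"
    and mom: "\<And>v. gauss_moment J y v = gauss_moment J x v"
    by metis
  define K where "K = J - {p}"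
  have K: "finite K" "p \<notin> K" "J = insert p K" using p insert.prems(1) by (auto simp: K_def)
  have K0: "d m j = 0" if "j \<in> K" for j using dm that K_def by auto
  have "d m p * d m p = (\<Sum>j\<in>J. d m j * d m j)" using K K0 by simp
  also have "\<dots> = 1" using gram insert.prems by simp
  finally have dmp: "d m p = 1 \<or> d m p = -1" by (simp add: square_eq_1_iff)
  \<comment> \<open>Only the entry at \<open>p\<close> of row \<open>m\<close> survives, so
    orthogonality to row \<open>m\<close> reads \<open>d n p * d m p = 0\<close>.\<close>
  have dnp: "d n p = 0" if "n \<in> N" for n
  proof -
    have "d n p * d m p = (\<Sum>j\<in>J. d n j * d m j)" using K K0 by simp
    also have "\<dots> = 0" using gram insert.prems that insert.hyps by auto
    finally show ?thesis using dmp by auto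
  qed
  have combn: "(\<Sum>j\<in>J. c n j *\<^sub>R x j) = (\<Sum>j\<in>K. d n j *\<^sub>R y j)" if "n \<in> N" for n
    using K dnp[OF that] comb[of n, symmetric] by simp
  have combm: "(\<Sum>j\<in>J. c m j *\<^sub>R x j) = d m p *\<^sub>R y p"
    using K K0 comb[of m, symmetric] by simp
  have gramK: "(\<Sum>j\<in>K. d n j * d l j) = (if n = l then 1 else 0)" if "n \<in> N" "l \<in> N" for n l
    using gram[of n l] insert.prems(2)[of n l] that dnp K by auto
  let ?z = "\<lambda>n. \<Sum>j\<in>K. d n j *\<^sub>R y j"
  have "gauss_moment (insert m N) (\<lambda>n. \<Sum>j\<in>J. c n j *\<^sub>R x j) v =
      (\<integral>\<^sup>+s. gauss_moment N (\<lambda>n. \<Sum>j\<in>J. c n j *\<^sub>R x j) (v + s *\<^sub>R (d m p *\<^sub>R y p)) \<partial>std_normal)"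
    unfolding gauss_moment_insert[OF insert.hyps(1,2)] combm ..
  also have "\<dots> = (\<integral>\<^sup>+s. gauss_moment N ?z (v + s *\<^sub>R (d m p *\<^sub>R y p)) \<partial>std_normal)"
    by (intro nn_integral_cong gauss_moment_cong combn)
  also have "\<dots> \<le> (\<integral>\<^sup>+s. gauss_moment K y (v + s *\<^sub>R (d m p *\<^sub>R y p)) \<partial>std_normal)"
    by (intro nn_integral_mono insert.IH K gramK)
  \<comment> \<open>The sign of the unit entry is absorbed by the symmetry of the Gaussian
    measure.\<close>
  also have "\<dots> = (\<integral>\<^sup>+s. gauss_moment K y (v + s *\<^sub>R y p) \<partial>std_normal)"
    using dmp
  proof
    assume "d m p = -1"
    then show ?thesis
      using nn_integral_std_normal_uminus[OF measurable_gauss_moment_line[OF K(1), of y v "y p"]] by simp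
  qed simp
  also have "\<dots> = gauss_moment J x v"
    using mom[of v] K by (simp add: gauss_moment_insert)
  finally show ?case .
qed

section \<open>Moments of a Gaussian sequence as integrals over a product measure\<close>

lemma gaussian_sequence_square_integrable:
  assumes "gaussian_sequence P \<gamma>" "n \<ge> 1"
  shows "integrable P (\<lambda>\<omega>. (\<gamma> n \<omega>)\<^sup>2)"
proof -
  have "distributed P lborel (\<gamma> n) std_normal_density"
    using assms by (simp add: gaussian_sequence_def)
  from distributed_integrable[OF this, of "\<lambda>x. x\<^sup>2"] integrable_std_normal_moment[of 2]
  show ?thesis by simp
qed

lemma gaussian_sequence_measurable:
  assumes "gaussian_sequence P \<gamma>" "n \<ge> 1"
  shows "\<gamma> n \<in> borel_measurable P"
proof -
  have "distributed P lborel (\<gamma> n) std_normal_density"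
    using assms by (simp add: gaussian_sequence_def)
  then show ?thesis using distributed_measurable[of P lborel "\<gamma> n"] by simp
qed

lemma gaussian_sum_measurable:
  assumes "gaussian_sequence P \<gamma>"
  shows "(\<lambda>\<omega>. norm (\<Sum>n=1..N. \<gamma> n \<omega> *\<^sub>R x n)) \<in> borel_measurable P"
  using borel_measurable_norm_sum_scaleR[where I="{1..N}" and f=\<gamma> and M=P and v=0 and x=x] gaussian_sequence_measurable[OF assms]
  by simp

lemma gaussian_sum_integrable:
  fixes x :: "nat \<Rightarrow> 'x::real_normed_vector"
  assumes "gaussian_sequence P \<gamma>"
  shows "integrable P (\<lambda>\<omega>. (norm (\<Sum>n=1..N. \<gamma> n \<omega> *\<^sub>R x n))\<^sup>2)"
proof (rule Bochner_Integration.integrable_bound)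
  \<comment> \<open>The factor \<open>real N\<close> comes from the Cauchy-Schwarz inequality for
    \<open>N\<close> summands.\<close>
  show "integrable P (\<lambda>\<omega>. (\<Sum>n=1..N. (\<gamma> n \<omega>)\<^sup>2 * (norm (x n))\<^sup>2) * real N)"
    using gaussian_sequence_square_integrable[OF assms] by auto
  show "(\<lambda>\<omega>. (norm (\<Sum>n=1..N. \<gamma> n \<omega> *\<^sub>R x n))\<^sup>2) \<in> borel_measurable P"
    using gaussian_sum_measurable[OF assms, where N=N and x=x] by measurable
  have "(norm (\<Sum>n=1..N. \<gamma> n \<omega> *\<^sub>R x n))\<^sup>2 \<le> (\<Sum>n=1..N. (\<gamma> n \<omega>)\<^sup>2 * (norm (x n))\<^sup>2) * real N" for \<omega>
  proof -
    have "norm (\<Sum>n=1..N. \<gamma> n \<omega> *\<^sub>R x n) \<le> (\<Sum>n=1..N. \<bar>\<gamma> n \<omega>\<bar> * norm (x n))"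
      using norm_sum[of "\<lambda>n. \<gamma> n \<omega> *\<^sub>R x n" "{1..N}"] by simp
    then have "(norm (\<Sum>n=1..N. \<gamma> n \<omega> *\<^sub>R x n))\<^sup>2 \<le> (\<Sum>n=1..N. \<bar>\<gamma> n \<omega>\<bar> * norm (x n))\<^sup>2"
      by (intro power_mono) auto
    also have "\<dots> \<le> (\<Sum>n=1..N. (\<bar>\<gamma> n \<omega>\<bar> * norm (x n))\<^sup>2) * real N"
      using sum_squared_le_sum_of_squares[of "\<lambda>n. \<bar>\<gamma> n \<omega>\<bar> * norm (x n)" "{1..N}"] by simp
    finally show ?thesis by (simp add: power_mult_distrib)
  qed
  then show "AE \<omega> in P. norm ((norm (\<Sum>n=1..N. \<gamma> n \<omega> *\<^sub>R x n))\<^sup>2) \<le>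
      norm ((\<Sum>n=1..N. (\<gamma> n \<omega>)\<^sup>2 * (norm (x n))\<^sup>2) * real N)"
    unfolding real_norm_def abs_power2 by (intro AE_I2 order_trans[OF _ abs_ge_self])
qed

lemma gaussian_sum_moment_eq_nn_integral:
  assumes "gaussian_sequence P \<gamma>"
  shows "ennreal (gaussian_sum_moment P \<gamma> N x) = (\<integral>\<^sup>+\<omega>. ennreal ((norm (\<Sum>n=1..N. \<gamma> n \<omega> *\<^sub>R x n))\<^sup>2) \<partial>P)"
  unfolding gaussian_sum_moment_def
  by (rule nn_integral_eq_integral[symmetric, OF gaussian_sum_integrable[OF assms]]) simp

lemma gaussian_sum_moment_nonneg: "0 \<le> gaussian_sum_moment P \<gamma> N x"
  unfolding gaussian_sum_moment_def by simp

lemma gaussian_sum_moment_eq_gauss_moment: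
  assumes "gaussian_sequence P \<gamma>"
  shows "ennreal (gaussian_sum_moment P \<gamma> N x) = gauss_moment {1..N} x 0"
\<comment> \<open>The description of the joint law of independent variables as a product measure is
  applied to a nonempty index set.\<close>
proof (cases "N = 0")
  case True
  then show ?thesis by (simp add: gaussian_sum_moment_def)
next
  case False
  interpret P: prob_space P using assms by (simp add: gaussian_sequence_def)
  let ?I = "{1..N}"
  have "P.indep_vars (\<lambda>_. borel) \<gamma> {1..}"
    using assms by (simp add: gaussian_sequence_def)
  then have indep: "P.indep_vars (\<lambda>_. borel) \<gamma> ?I"
    by (rule P.indep_vars_subset) auto
  have meas: "\<gamma> i \<in> borel_measurable P" if "i \<in> ?I" for i
    using gaussian_sequence_measurable[OF assms] that by simp
  have "distr P borel (\<gamma> i) = std_normal" if "i \<in> ?I" for i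
  proof -
    have "distr P lborel (\<gamma> i) = std_normal"
      using assms that by (simp add: gaussian_sequence_def distributed_distr_eq_density)
    \<comment> \<open>\<open>distr\<close> depends on its target only through the sigma-algebra,
      which \<open>lborel\<close> and \<open>borel\<close> share.\<close>
    moreover have "distr P lborel (\<gamma> i) = distr P borel (\<gamma> i)" by (rule distr_cong) auto
    ultimately show ?thesis by simp
  qed
  then have PiM: "(\<Pi>\<^sub>M i\<in>?I. distr P borel (\<gamma> i)) = (\<Pi>\<^sub>M i\<in>?I. std_normal)"
    by (intro PiM_cong) auto
  have joint: "distr P (\<Pi>\<^sub>M i\<in>?I. borel) (\<lambda>\<omega>. \<lambda>i\<in>?I. \<gamma> i \<omega>) = (\<Pi>\<^sub>M i\<in>?I. std_normal)"
    using P.indep_vars_iff_distr_eq_PiM'[of ?I \<gamma> "\<lambda>_. borel"] False indep meas PiM by simp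
  have sets: "sets (\<Pi>\<^sub>M i\<in>?I. borel :: real measure) = sets (\<Pi>\<^sub>M i\<in>?I. std_normal)"
    by (rule sets_PiM_cong) auto
  have restrict: "(\<lambda>\<omega>. \<lambda>i\<in>?I. \<gamma> i \<omega>) \<in> P \<rightarrow>\<^sub>M (\<Pi>\<^sub>M i\<in>?I. borel)"
    using meas by (intro measurable_restrict) auto
  have integrand: "(\<lambda>t. ennreal ((norm (0 + (\<Sum>i\<in>?I. t i *\<^sub>R x i)))\<^sup>2)) \<in> borel_measurable (\<Pi>\<^sub>M i\<in>?I. borel)"
    using measurable_gauss_moment_integrand[where v=0 and I="?I" and x=x]
    by (subst measurable_cong_sets[OF sets refl])
  have "gauss_moment ?I x 0 =
      (\<integral>\<^sup>+\<omega>. ennreal ((norm (0 + (\<Sum>i\<in>?I. (\<lambda>i\<in>?I. \<gamma> i \<omega>) i *\<^sub>R x i)))\<^sup>2) \<partial>P)"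
    unfolding gauss_moment_def joint[symmetric]
    by (rule nn_integral_distr[OF restrict]) (use integrand in simp)
  also have "\<dots> = ennreal (gaussian_sum_moment P \<gamma> N x)"
    unfolding gaussian_sum_moment_eq_nn_integral[OF assms]
    by (intro nn_integral_cong arg_cong[where f=ennreal] arg_cong[where f="\<lambda>z. (norm z)\<^sup>2"])
      (auto intro!: sum.cong)
  finally show ?thesis ..
qed

subsection \<open>Square integrable functions\<close>

lemma L2_measurable: "f \<in> L2 M \<Longrightarrow> f \<in> borel_measurable M"
  by (simp add: L2_def)

lemma L2_integrable_mult:
  assumes "f \<in> L2 M" "g \<in> L2 M"
  shows "integrable M (\<lambda>x. f x * g x)"
proof (rule Bochner_Integration.integrable_bound)
  show "integrable M (\<lambda>x. (f x)\<^sup>2 + (g x)\<^sup>2)" using assms by (simp add: L2_def)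
  show "(\<lambda>x. f x * g x) \<in> borel_measurable M"
    by (rule borel_measurable_times[OF assms[THEN L2_measurable]])
  have "\<bar>a * b\<bar> \<le> a\<^sup>2 + b\<^sup>2" for a b :: real
  proof -
    have "0 \<le> (\<bar>a\<bar> - \<bar>b\<bar>)\<^sup>2" "0 \<le> \<bar>a\<bar> * \<bar>b\<bar>" by simp_all
    then show ?thesis unfolding power2_diff abs_mult power2_abs by linarith
  qed
  then show "AE x in M. norm (f x * g x) \<le> norm ((f x)\<^sup>2 + (g x)\<^sup>2)"
    by simp
qed

lemma L2_add:
  assumes "f \<in> L2 M" "g \<in> L2 M"
  shows "(\<lambda>x. f x + g x) \<in> L2 M"
proof -
  have "integrable M (\<lambda>x. (f x)\<^sup>2 + (g x)\<^sup>2 + 2 * (f x * g x))"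
    using assms L2_integrable_mult[OF assms] by (simp add: L2_def)
  moreover have "(\<lambda>x. f x + g x) \<in> borel_measurable M"
    by (rule borel_measurable_add[OF assms[THEN L2_measurable]])
  ultimately show ?thesis by (simp add: L2_def power2_sum mult.assoc)
qed

lemma L2_cmult:
  assumes "f \<in> L2 M"
  shows "(\<lambda>x. c * f x) \<in> L2 M"
proof -
  have "integrable M (\<lambda>x. c\<^sup>2 * (f x)\<^sup>2)" using assms by (simp add: L2_def)
  then show ?thesis
    unfolding L2_def mem_Collect_eq power_mult_distrib
    by (rule conjI[OF borel_measurable_times[OF borel_measurable_const L2_measurable[OF assms]]])
qed

lemma L2_diff:
  assumes "f \<in> L2 M" "g \<in> L2 M"
  shows "(\<lambda>x. f x - g x) \<in> L2 M"
  using L2_add[OF assms(1) L2_cmult[OF assms(2), of "-1"]] by simp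

lemma L2_sum:
  assumes "\<And>i. i \<in> I \<Longrightarrow> f i \<in> L2 M"
  shows "(\<lambda>x. \<Sum>i\<in>I. f i x) \<in> L2 M"
  using assms
proof (induction I rule: infinite_finite_induct)
  case (insert i I)
  then show ?case using L2_add[of "f i" M "\<lambda>x. \<Sum>i\<in>I. f i x"] by simp
qed (simp_all add: L2_def)

lemma L2_inner_commute: "L2_inner M f g = L2_inner M g f"
  by (simp add: L2_inner_def mult.commute)

lemma L2_inner_add_left:
  "f \<in> L2 M \<Longrightarrow> g \<in> L2 M \<Longrightarrow> h \<in> L2 M \<Longrightarrow>
    L2_inner M (\<lambda>x. f x + g x) h = L2_inner M f h + L2_inner M g h"
  by (simp add: L2_inner_def distrib_right L2_integrable_mult)

lemma L2_inner_diff_left: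
  "f \<in> L2 M \<Longrightarrow> g \<in> L2 M \<Longrightarrow> h \<in> L2 M \<Longrightarrow>
    L2_inner M (\<lambda>x. f x - g x) h = L2_inner M f h - L2_inner M g h"
  by (simp add: L2_inner_def left_diff_distrib L2_integrable_mult)

lemma L2_inner_cmult_left: "L2_inner M (\<lambda>x. c * f x) g = c * L2_inner M f g"
  by (simp add: L2_inner_def mult.assoc)

lemma L2_inner_sum_left:
  assumes "\<And>i. i \<in> I \<Longrightarrow> f i \<in> L2 M" "g \<in> L2 M"
  shows "L2_inner M (\<lambda>x. \<Sum>i\<in>I. f i x) g = (\<Sum>i\<in>I. L2_inner M (f i) g)"
  using assms by (simp add: L2_inner_def sum_distrib_right L2_integrable_mult)

lemma L2_inner_self_nonneg: "0 \<le> L2_inner M f f"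
  by (simp add: L2_inner_def)

lemma L2_norm_nonneg [simp]: "0 \<le> L2_norm M f"
  by (simp add: L2_norm_def L2_inner_self_nonneg)

lemma L2_norm_square: "(L2_norm M f)\<^sup>2 = L2_inner M f f"
  by (simp add: L2_norm_def L2_inner_self_nonneg)

lemma L2_norm_cmult: "L2_norm M (\<lambda>x. c * f x) = \<bar>c\<bar> * L2_norm M f"
proof -
  have "L2_inner M (\<lambda>x. c * f x) (\<lambda>x. c * f x) = c\<^sup>2 * L2_inner M f f"
    by (simp add: L2_inner_def power2_eq_square mult_ac)
  then show ?thesis by (simp add: L2_norm_def real_sqrt_mult)
qed

lemma L2_norm_minus_commute: "L2_norm M (\<lambda>x. f x - g x) = L2_norm M (\<lambda>x. g x - f x)"
  using L2_norm_cmult[of M "-1" "\<lambda>x. g x - f x"] by simp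

lemma L2_Cauchy_Schwarz:
  assumes "f \<in> L2 M" "g \<in> L2 M"
  shows "\<bar>L2_inner M f g\<bar> \<le> L2_norm M f * L2_norm M g"
proof -
  let ?A = "L2_inner M f f" and ?B = "L2_inner M f g" and ?C = "L2_inner M g g"
  have q: "0 \<le> ?A - 2 * t * ?B + t\<^sup>2 * ?C" for t
  proof -
    have tg: "(\<lambda>x. t * g x) \<in> L2 M" by (rule L2_cmult) fact
    have "0 \<le> L2_inner M (\<lambda>x. f x - t * g x) (\<lambda>x. f x - t * g x)" by (rule L2_inner_self_nonneg)
    also have "\<dots> = ?A - 2 * t * ?B + t\<^sup>2 * ?C"
      using assms tg
      by (simp add: L2_inner_diff_left L2_diff L2_inner_cmult_left
          L2_inner_commute[of M f "\<lambda>x. f x - t * g x"] L2_inner_commute[of M g "\<lambda>x. f x - t * g x"]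
          L2_inner_commute[of M g f] power2_eq_square algebra_simps)
    finally show ?thesis .
  qed
  have "?B\<^sup>2 \<le> ?A * ?C"
  \<comment> \<open>The form is only semidefinite on functions, so \<open>?C = 0\<close> needs its
    own argument: if \<open>?B\<close> were nonzero, \<open>q\<close> at
    \<open>(?A + 1) / (2 * ?B)\<close> would have value -1. Otherwise \<open>?B / ?C\<close> is the
    minimiser of the quadratic.\<close>
  proof (cases "?C = 0")
    case True
    have "?B = 0"
    proof (rule ccontr)
      assume "?B \<noteq> 0"
      then show False using q[of "(?A + 1) / (2 * ?B)"] True by simp
    qed
    then show ?thesis using True by simp
  next
    case False
    then have "?C > 0" using L2_inner_self_nonneg[of M g] by simp
    moreover have "?A - 2 * (?B / ?C) * ?B + (?B / ?C)\<^sup>2 * ?C = ?A - ?B\<^sup>2 / ?C"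
      using False by (simp add: power2_eq_square)
    then have "?B\<^sup>2 / ?C \<le> ?A" using q[of "?B / ?C"] by linarith
    ultimately show ?thesis by (simp only: pos_divide_le_eq)
  qed
  then have "sqrt (?B\<^sup>2) \<le> sqrt (?A * ?C)" by (rule real_sqrt_le_mono)
  then show ?thesis by (simp add: L2_norm_def real_sqrt_mult)
qed

lemma L2_norm_triangle:
  assumes "f \<in> L2 M" "g \<in> L2 M"
  shows "L2_norm M (\<lambda>x. f x + g x) \<le> L2_norm M f + L2_norm M g"
proof (rule power2_le_imp_le)
  have fg: "(\<lambda>x. f x + g x) \<in> L2 M" by (rule L2_add[OF assms])
  have "(L2_norm M (\<lambda>x. f x + g x))\<^sup>2 = (L2_norm M f)\<^sup>2 + 2 * L2_inner M f g + (L2_norm M g)\<^sup>2"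
    unfolding L2_norm_square using assms fg
    by (simp add: L2_inner_add_left
        L2_inner_commute[of M f "\<lambda>x. f x + g x"] L2_inner_commute[of M g "\<lambda>x. f x + g x"]
        L2_inner_commute[of M g f])
  also have "\<dots> \<le> (L2_norm M f + L2_norm M g)\<^sup>2"
    using L2_Cauchy_Schwarz[OF assms] by (simp add: power2_sum)
  finally show "(L2_norm M (\<lambda>x. f x + g x))\<^sup>2 \<le> (L2_norm M f + L2_norm M g)\<^sup>2" .
qed simp

lemma L2_norm_diff_triangle:
  assumes "f \<in> L2 M" "g \<in> L2 M" "h \<in> L2 M"
  shows "L2_norm M (\<lambda>x. f x - h x) \<le> L2_norm M (\<lambda>x. f x - g x) + L2_norm M (\<lambda>x. g x - h x)"
  using L2_norm_triangle[OF L2_diff[OF assms(1,2)] L2_diff[OF assms(2,3)]] by simp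

lemma L2_norm_sum:
  assumes "\<And>i. i \<in> I \<Longrightarrow> f i \<in> L2 M"
  shows "L2_norm M (\<lambda>x. \<Sum>i\<in>I. f i x) \<le> (\<Sum>i\<in>I. L2_norm M (f i))"
  using assms
proof (induction I rule: infinite_finite_induct)
  case (insert i I)
  have "L2_norm M (\<lambda>x. f i x + (\<Sum>i\<in>I. f i x)) \<le> L2_norm M (f i) + L2_norm M (\<lambda>x. \<Sum>i\<in>I. f i x)"
    using insert.prems by (intro L2_norm_triangle L2_sum) auto
  then show ?case using insert by fastforce
qed (simp_all add: L2_norm_def L2_inner_def)

section \<open>Approximation by simple functions, keeping orthonormality\<close>

lemma simple_function_in_L2:
  fixes s :: "'a \<Rightarrow> real"
  assumes "prob_space M" "simple_function M s"
  shows "s \<in> L2 M"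
proof -
  interpret prob_space M by fact
  have [measurable]: "s \<in> borel_measurable M" by (rule borel_measurable_simple_function) fact
  have fin: "finite ((\<lambda>x. (s x)\<^sup>2) ` space M)"
    using simple_functionD(1)[OF assms(2)] by (auto simp: image_image[symmetric, of "\<lambda>y. y\<^sup>2" s])
  have "integrable M (\<lambda>x. (s x)\<^sup>2)"
  proof (rule integrable_const_bound)
    show "AE x in M. norm ((s x)\<^sup>2) \<le> Max ((\<lambda>x. (s x)\<^sup>2) ` space M)"
      using fin by (auto intro!: AE_I2 Max_ge)
  qed measurable
  then show ?thesis by (simp add: L2_def)
qed

lemma L2_simple_approximation:
  assumes f: "f \<in> L2 M"
  obtains s where "\<And>k. simple_function M (s k)" "\<And>k. s k \<in> L2 M"
    "(\<lambda>k. L2_norm M (\<lambda>x. s k x - f x)) \<longlonglongrightarrow> 0"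
proof -
  have fm [measurable]: "f \<in> borel_measurable M" by (rule L2_measurable) fact
  have fi: "integrable M (\<lambda>x. (f x)\<^sup>2)" using f by (simp add: L2_def)
  from borel_measurable_implies_sequence_metric[OF fm, of 0] obtain s where
    s: "\<And>i. simple_function M (s i)" and
    lim: "\<And>x. x \<in> space M \<Longrightarrow> (\<lambda>i. s i x) \<longlonglongrightarrow> f x" and
    bound: "\<And>i x. x \<in> space M \<Longrightarrow> \<bar>s i x\<bar> \<le> 2 * \<bar>f x\<bar>"
    by simp metis
  have [measurable]: "s i \<in> borel_measurable M" for i by (rule borel_measurable_simple_function) fact
  have "(\<lambda>k. \<integral>x. (s k x - f x) * (s k x - f x) \<partial>M) \<longlonglongrightarrow> (\<integral>x. 0 \<partial>M)"
  proof (rule integral_dominated_convergence)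
    \<comment> \<open>From \<open>\<bar>s k x\<bar> \<le> 2 * \<bar>f x\<bar>\<close> the difference
      is at most \<open>3 * \<bar>f x\<bar>\<close>; squaring gives 9.\<close>
    show "integrable M (\<lambda>x. 9 * (f x)\<^sup>2)" using fi by simp
    show "AE x in M. (\<lambda>k. (s k x - f x) * (s k x - f x)) \<longlonglongrightarrow> 0"
    proof (rule AE_I2)
      fix x assume "x \<in> space M"
      then have "(\<lambda>k. (s k x - f x) * (s k x - f x)) \<longlonglongrightarrow> (f x - f x) * (f x - f x)"
        by (intro tendsto_intros lim)
      then show "(\<lambda>k. (s k x - f x) * (s k x - f x)) \<longlonglongrightarrow> 0" by simp
    qed
    show "AE x in M. norm ((s k x - f x) * (s k x - f x)) \<le> 9 * (f x)\<^sup>2" for k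
    proof (rule AE_I2)
      fix x assume "x \<in> space M"
      then have "\<bar>s k x - f x\<bar> \<le> 3 * \<bar>f x\<bar>" using bound[of x k] by linarith
      then have "\<bar>s k x - f x\<bar>\<^sup>2 \<le> (3 * \<bar>f x\<bar>)\<^sup>2" by (intro power_mono) auto
      then show "norm ((s k x - f x) * (s k x - f x)) \<le> 9 * (f x)\<^sup>2"
        by (simp add: power2_eq_square)
    qed
  qed measurable
  then have "(\<lambda>k. sqrt (\<integral>x. (s k x - f x) * (s k x - f x) \<partial>M)) \<longlonglongrightarrow> sqrt 0"
    by (intro tendsto_real_sqrt) simp
  then have conv: "(\<lambda>k. L2_norm M (\<lambda>x. s k x - f x)) \<longlonglongrightarrow> 0"
    by (simp add: L2_norm_def L2_inner_def)
  have "s k \<in> L2 M" for k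
  proof -
    have "integrable M (\<lambda>x. (s k x)\<^sup>2)"
    proof (rule Bochner_Integration.integrable_bound)
      show "integrable M (\<lambda>x. 4 * (f x)\<^sup>2)" using fi by simp
      show "AE x in M. norm ((s k x)\<^sup>2) \<le> norm (4 * (f x)\<^sup>2)"
      proof (rule AE_I2)
        fix x assume "x \<in> space M"
        then have "\<bar>s k x\<bar>\<^sup>2 \<le> (2 * \<bar>f x\<bar>)\<^sup>2" using bound by (intro power_mono) auto
        then show "norm ((s k x)\<^sup>2) \<le> norm (4 * (f x)\<^sup>2)" by (simp add: power_mult_distrib)
      qed
    qed measurable
    then show ?thesis by (simp add: L2_def)
  qed
  then show ?thesis by (rule that[OF s _ conv])
qed

text \<open>Gram--Schmidt orthogonalisation of simple approximations, one vector at a time.\<close>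

lemma L2_orthonormal_simple_approximation:
  assumes "prob_space M" "L2_orthonormal M N h" "\<epsilon> > 0"
  shows "\<exists>s. L2_orthonormal M N s \<and> (\<forall>i\<in>{1..N}. simple_function M (s i)) \<and>
    (\<forall>i\<in>{1..N}. L2_norm M (\<lambda>x. s i x - h i x) < \<epsilon>)"
  using assms(2,3)
proof (induction N arbitrary: \<epsilon>)
  case 0
  then show ?case by (simp add: L2_orthonormal_def)
next
  case (Suc N)
  \<comment> \<open>The error budget: \<open>u\<close> is off by \<open>\<delta>\<close>, and
    subtracting the projection onto \<open>N\<close> vectors with coefficients at most
    \<open>2 * \<delta>\<close> costs \<open>2 * real N * \<delta>\<close>, together
    \<open>?k * \<delta>\<close>. Normalising costs at most the same again. Hence
    \<open>2 * (?k * \<delta>) < \<epsilon>\<close> is required, and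
    \<open>?k * \<delta> < 1\<close> keeps the norm to be divided by positive.\<close>
  let ?k = "2 * real N + 1"
  define \<delta> where "\<delta> = min \<epsilon> 1 / (4 * ?k)"
  have \<delta>: "\<delta> > 0" unfolding \<delta>_def using Suc.prems(2) by (intro divide_pos_pos) auto
  have \<delta>k: "?k * \<delta> = min \<epsilon> 1 / 4" unfolding \<delta>_def by (simp add: field_simps)
  have "?k * \<delta> < 1" "2 * (?k * \<delta>) < \<epsilon>" unfolding \<delta>k using Suc.prems(2) by auto
  note small = this
  have "L2_orthonormal M N h" using Suc.prems(1) by (simp add: L2_orthonormal_def)
  from Suc.IH[OF this \<delta>] obtain s where so: "L2_orthonormal M N s"
    and ss: "\<And>i. i \<in> {1..N} \<Longrightarrow> simple_function M (s i)"
    and sh: "\<And>i. i \<in> {1..N} \<Longrightarrow> L2_norm M (\<lambda>x. s i x - h i x) < \<delta>"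
    by blast
  have sL: "s i \<in> L2 M" if "i \<in> {1..N}" for i using so that by (simp add: L2_orthonormal_def)
  have hL: "h i \<in> L2 M" if "i \<in> {1..Suc N}" for i
    using Suc.prems(1) that by (simp add: L2_orthonormal_def)
  let ?g = "h (Suc N)"
  have gL: "?g \<in> L2 M" by (rule hL) simp
  have g1: "L2_norm M ?g = 1" using Suc.prems(1) by (simp add: L2_orthonormal_def L2_norm_def)
  have s1: "L2_norm M (s i) = 1" if "i \<in> {1..N}" for i
    using so that by (simp add: L2_orthonormal_def L2_norm_def)
  obtain u where u: "simple_function M u" "u \<in> L2 M" "L2_norm M (\<lambda>x. u x - ?g x) < \<delta>"
  proof -
    obtain r where r: "\<And>k. simple_function M (r k)" "\<And>k. r k \<in> L2 M"
      "(\<lambda>k. L2_norm M (\<lambda>x. r k x - ?g x)) \<longlonglongrightarrow> 0"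
      by (rule L2_simple_approximation[OF gL]) (rule that)
    from order_tendstoD(2)[OF r(3) \<delta>] obtain k where k: "L2_norm M (\<lambda>x. r k x - ?g x) < \<delta>"
      unfolding eventually_sequentially by blast
    show ?thesis by (rule that[OF r(1,2) k])
  qed
  define a where "a i = L2_inner M u (s i)" for i
  have abound: "\<bar>a i\<bar> \<le> 2 * \<delta>" if i: "i \<in> {1..N}" for i
  proof -
    have i': "i \<in> {1..Suc N}" using i by simp
    \<comment> \<open>The exact systems satisfy this orthogonality, so the coefficient
      \<open>a i\<close> splits into two errors, one from \<open>u\<close> in place of
      \<open>?g\<close> and one from \<open>s i\<close> in place of \<open>h i\<close>.\<close>
    have "L2_inner M ?g (h i) = 0"
      using Suc.prems(1) i by (auto simp: L2_orthonormal_def)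
    then have "L2_inner M ?g (\<lambda>x. s i x - h i x) = L2_inner M ?g (s i)"
      using L2_inner_diff_left[OF sL[OF i] hL[OF i'] gL] by (simp add: L2_inner_commute)
    then have "a i = L2_inner M (\<lambda>x. u x - ?g x) (s i) + L2_inner M ?g (\<lambda>x. s i x - h i x)"
      using L2_inner_diff_left[OF u(2) gL sL[OF i]] by (simp add: a_def)
    moreover have "\<bar>L2_inner M (\<lambda>x. u x - ?g x) (s i)\<bar> \<le> \<delta>"
      using L2_Cauchy_Schwarz[OF L2_diff[OF u(2) gL] sL[OF i]] s1[OF i] u(3) by simp
    moreover have "\<bar>L2_inner M ?g (\<lambda>x. s i x - h i x)\<bar> \<le> \<delta>"
      using L2_Cauchy_Schwarz[OF gL L2_diff[OF sL[OF i] hL[OF i']]] g1 sh[OF i] by simp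
    ultimately show ?thesis by linarith
  qed
  define p where "p = (\<lambda>x. \<Sum>i\<in>{1..N}. a i * s i x)"
  have pL: "p \<in> L2 M" unfolding p_def by (intro L2_sum L2_cmult sL)
  have pnorm: "L2_norm M p \<le> 2 * real N * \<delta>"
  proof -
    have "L2_norm M p \<le> (\<Sum>i\<in>{1..N}. L2_norm M (\<lambda>x. a i * s i x))"
      unfolding p_def by (intro L2_norm_sum L2_cmult sL)
    also have "\<dots> = (\<Sum>i\<in>{1..N}. \<bar>a i\<bar>)" by (rule sum.cong) (simp_all add: L2_norm_cmult s1)
    also have "\<dots> \<le> (\<Sum>i\<in>{1..N}. 2 * \<delta>)" by (intro sum_mono abound)
    finally show ?thesis by simp
  qed
  define w where "w = (\<lambda>x. u x - p x)"
  have wL: "w \<in> L2 M" unfolding w_def by (rule L2_diff) fact+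
  have wsimple: "simple_function M w"
    unfolding w_def p_def
    by (intro simple_function_diff simple_function_sum simple_function_mult simple_function_const u ss)
  have wg: "L2_norm M (\<lambda>x. w x - ?g x) \<le> ?k * \<delta>"
  proof -
    have "L2_norm M (\<lambda>x. w x - u x) = L2_norm M p"
      using L2_norm_minus_commute[of M w u] by (simp add: w_def)
    then show ?thesis using L2_norm_diff_triangle[OF wL u(2) gL] pnorm u(3) by (simp add: algebra_simps)
  qed
  have worth: "L2_inner M w (s j) = 0" if j: "j \<in> {1..N}" for j
  proof -
    have "L2_inner M p (s j) = (\<Sum>i\<in>{1..N}. a i * L2_inner M (s i) (s j))"
      unfolding p_def using sL j by (subst L2_inner_sum_left) (auto simp: L2_cmult L2_inner_cmult_left)
    also have "\<dots> = (\<Sum>i\<in>{1..N}. if i = j then a i else 0)"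
      by (rule sum.cong) (use so j in \<open>auto simp: L2_orthonormal_def\<close>)
    also have "\<dots> = a j" using j by simp
    finally show ?thesis
      unfolding w_def using L2_inner_diff_left[OF u(2) pL sL[OF j]] by (simp add: a_def)
  qed
  define \<rho> where "\<rho> = L2_norm M w"
  have \<rho>1: "\<bar>1 - \<rho>\<bar> \<le> ?k * \<delta>"
  proof -
    have "\<rho> \<le> 1 + L2_norm M (\<lambda>x. w x - ?g x)"
      using L2_norm_triangle[OF L2_diff[OF wL gL] gL] g1 by (simp add: \<rho>_def)
    moreover have "1 \<le> \<rho> + L2_norm M (\<lambda>x. w x - ?g x)"
      using L2_norm_triangle[OF L2_diff[OF gL wL] wL] g1 L2_norm_minus_commute[of M w ?g]
      by (simp add: \<rho>_def)
    ultimately show ?thesis using wg by linarith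
  qed
  then have \<rho>0: "\<rho> > 0" using small(1) by linarith
  define v where "v = (\<lambda>x. (1 / \<rho>) * w x)"
  have vL: "v \<in> L2 M" unfolding v_def by (rule L2_cmult) fact
  have vsimple: "simple_function M v"
    unfolding v_def by (intro simple_function_mult simple_function_const wsimple)
  have vg: "L2_norm M (\<lambda>x. v x - ?g x) < \<epsilon>"
  proof -
    have "L2_norm M (\<lambda>x. v x - w x) = L2_norm M (\<lambda>x. (1 / \<rho> - 1) * w x)"
      by (simp add: v_def left_diff_distrib)
    also have "\<dots> = \<bar>1 / \<rho> - 1\<bar> * \<bar>\<rho>\<bar>" using \<rho>0 by (simp add: L2_norm_cmult \<rho>_def)
    also have "\<dots> = \<bar>1 - \<rho>\<bar>"
    proof -
      have "(1 / \<rho> - 1) * \<rho> = 1 - \<rho>" using \<rho>0 by (simp add: left_diff_distrib)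
      then show ?thesis by (simp only: abs_mult[symmetric])
    qed
    finally show ?thesis
      using L2_norm_diff_triangle[OF vL wL gL] wg \<rho>1 small(2) by linarith
  qed
  have vs: "L2_inner M v (s j) = 0" if "j \<in> {1..N}" for j
    unfolding v_def L2_inner_cmult_left worth[OF that] by simp
  have sv: "L2_inner M (s j) v = 0" if "j \<in> {1..N}" for j
    using vs[OF that] by (simp add: L2_inner_commute)
  have "L2_norm M v = \<bar>1 / \<rho>\<bar> * \<rho>" unfolding v_def \<rho>_def by (rule L2_norm_cmult)
  then have "L2_norm M v = 1" using \<rho>0 by simp
  then have vv: "L2_inner M v v = 1" using L2_norm_square[of M v] by simp
  have \<delta>\<epsilon>: "\<delta> < \<epsilon>"
  proof -
    have "\<delta> \<le> ?k * \<delta>" using \<delta> by (simp add: algebra_simps)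
    then show ?thesis using small(2) \<delta> by linarith
  qed
  have "L2_orthonormal M (Suc N) (s(Suc N := v))"
    using so vL vv vs sv
    by (auto simp: L2_orthonormal_def le_Suc_eq)
  moreover have "simple_function M ((s(Suc N := v)) i)" if "i \<in> {1..Suc N}" for i
    using ss that vsimple by (cases "i = Suc N") auto
  moreover have "L2_norm M (\<lambda>x. (s(Suc N := v)) i x - h i x) < \<epsilon>" if "i \<in> {1..Suc N}" for i
    using sh[of i] that vg \<delta>\<epsilon> by (cases "i = Suc N") auto
  ultimately show ?case by blast
qed

subsection \<open>Vector measures and simple functions\<close>

lemma vector_measure_empty:
  assumes "vector_measure M F"
  shows "F {} = 0"
proof -
  have "(\<lambda>n::nat. F {}) sums F (\<Union>n::nat. {})"
    using assms unfolding vector_measure_def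
    by (elim allE[where x="\<lambda>n::nat. {}"]) (auto simp: disjoint_family_on_def)
  then have "(\<lambda>n::nat. F {}) \<longlonglongrightarrow> 0" by (intro summable_LIMSEQ_zero sums_summable)
  then show ?thesis by (simp add: LIMSEQ_const_iff)
qed

lemma vector_measure_Un:
  assumes F: "vector_measure M F" and AB: "A \<in> sets M" "B \<in> sets M" "A \<inter> B = {}"
  shows "F (A \<union> B) = F A + F B"
proof -
  have "disjoint_family (binaryset A B)"
    using AB(3) by (auto simp: disjoint_family_on_def binaryset_def fun_upd_def)
  then have "(\<lambda>n. F (binaryset A B n)) sums F (\<Union>n. binaryset A B n)"
    using F AB(1,2) unfolding vector_measure_def by (metis range_binaryset_eq insert_subset sets.empty_sets empty_subsetI)
  moreover have "(\<lambda>n. F (binaryset A B n)) sums (\<Sum>n\<in>{0, 1}. F (binaryset A B n))"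
    using vector_measure_empty[OF F] by (intro sums_finite) (auto simp: binaryset_def)
  ultimately show ?thesis
    by (auto dest: sums_unique2 simp: UN_binaryset_eq binaryset_def)
qed

lemma vector_measure_finite_UN:
  assumes F: "vector_measure M F" and "finite I" "\<And>i. i \<in> I \<Longrightarrow> A i \<in> sets M" "disjoint_family_on A I"
  shows "F (\<Union>i\<in>I. A i) = (\<Sum>i\<in>I. F (A i))"
  using assms(2-)
proof (induction I rule: finite_induct)
  case empty
  then show ?case using vector_measure_empty[OF F] by simp
next
  case (insert i I)
  have "A i \<inter> (\<Union>j\<in>I. A j) = {}"
    using insert.prems(2) insert.hyps(2) by (auto simp: disjoint_family_on_def)
  then have "F (A i \<union> (\<Union>j\<in>I. A j)) = F (A i) + F (\<Union>j\<in>I. A j)"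
    using insert.prems(1) insert.hyps(1) by (intro vector_measure_Un[OF F]) auto
  moreover have "disjoint_family_on A I" using insert.prems(2) by (auto simp: disjoint_family_on_def)
  ultimately show ?case using insert by simp
qed

section \<open>Integration of simple functions against a vector measure\<close>

definition simple_vector_integral :: "'a measure \<Rightarrow> ('a set \<Rightarrow> 'x::real_vector) \<Rightarrow> ('a \<Rightarrow> real) \<Rightarrow> 'x" where
  "simple_vector_integral M F f = (\<Sum>y\<in>f ` space M. y *\<^sub>R F (f -` {y} \<inter> space M))"

text \<open>The integral may be computed over any finite partition finer than the level sets of
  \<open>f\<close>: finite additivity of \<open>F\<close> regroups the cells of \<open>k\<close> on
  which \<phi> takes the same value. With \<open>k\<close> a pair this gives additivity; with
  \<open>k\<close> a list it puts a whole system on one partition.\<close>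

lemma simple_vector_integral_comp:
  assumes F: "vector_measure M F" and k: "simple_function M k"
    and f: "\<And>x. x \<in> space M \<Longrightarrow> f x = \<phi> (k x)"
  shows "simple_vector_integral M F f = (\<Sum>z\<in>k ` space M. \<phi> z *\<^sub>R F (k -` {z} \<inter> space M))"
proof -
  have fin: "finite (k ` space M)" by (rule simple_functionD(1)[OF k])
  have img: "f ` space M = \<phi> ` k ` space M" using f by (auto simp: image_image)
  have "(\<Sum>z\<in>k ` space M. \<phi> z *\<^sub>R F (k -` {z} \<inter> space M)) =
      (\<Sum>y\<in>f ` space M. \<Sum>z\<in>{z\<in>k ` space M. \<phi> z = y}. \<phi> z *\<^sub>R F (k -` {z} \<inter> space M))"
    by (rule sum.group[symmetric]) (use fin img in auto)
  also have "\<dots> = simple_vector_integral M F f"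
    unfolding simple_vector_integral_def
  proof (rule sum.cong[OF refl])
    fix y
    let ?Z = "{z\<in>k ` space M. \<phi> z = y}"
    have "f -` {y} \<inter> space M = (\<Union>z\<in>?Z. k -` {z} \<inter> space M)" using f by auto
    also have "F \<dots> = (\<Sum>z\<in>?Z. F (k -` {z} \<inter> space M))"
      using fin simple_functionD(2)[OF k]
      by (intro vector_measure_finite_UN[OF F]) (auto simp: disjoint_family_on_def)
    finally show "(\<Sum>z\<in>?Z. \<phi> z *\<^sub>R F (k -` {z} \<inter> space M)) = y *\<^sub>R F (f -` {y} \<inter> space M)"
      by (simp add: scaleR_sum_right)
  qed
  finally show ?thesis ..
qed

lemma simple_vector_integral_add:
  assumes F: "vector_measure M F" and "simple_function M f" "simple_function M g"
  shows "simple_vector_integral M F (\<lambda>x. f x + g x) = simple_vector_integral M F f + simple_vector_integral M F g"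
proof -
  let ?k = "\<lambda>x. (f x, g x)"
  have k: "simple_function M ?k" using assms by (intro simple_function_Pair)
  note comp = simple_vector_integral_comp[OF F k]
  have 1: "simple_vector_integral M F (\<lambda>x. f x + g x) =
      (\<Sum>z\<in>?k ` space M. (fst z + snd z) *\<^sub>R F (?k -` {z} \<inter> space M))"
    by (rule comp) simp
  have 2: "simple_vector_integral M F f = (\<Sum>z\<in>?k ` space M. fst z *\<^sub>R F (?k -` {z} \<inter> space M))"
    by (rule comp) simp
  have 3: "simple_vector_integral M F g = (\<Sum>z\<in>?k ` space M. snd z *\<^sub>R F (?k -` {z} \<inter> space M))"
    by (rule comp) simp
  show ?thesis unfolding 1 2 3 scaleR_left_distrib sum.distrib ..
qed

lemma simple_vector_integral_cmult:
  assumes F: "vector_measure M F" and f: "simple_function M f"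
  shows "simple_vector_integral M F (\<lambda>x. c * f x) = c *\<^sub>R simple_vector_integral M F f"
  by (subst simple_vector_integral_comp[OF F f, of _ "\<lambda>y. c * y"])
    (simp_all add: simple_vector_integral_def scaleR_sum_right)

lemma simple_vector_integral_diff:
  assumes F: "vector_measure M F" and f: "simple_function M f" and g: "simple_function M g"
  shows "simple_vector_integral M F (\<lambda>x. f x - g x) = simple_vector_integral M F f - simple_vector_integral M F g"
proof -
  have "simple_function M (\<lambda>x. (-1) * g x)" by (intro simple_function_mult simple_function_const g)
  from simple_vector_integral_add[OF F f this] show ?thesis
    using simple_vector_integral_cmult[OF F g, of "-1"] by simp
qed

lemma simple_vector_integral_indicator:
  assumes F: "vector_measure M F" and A: "A \<in> sets M"
  shows "simple_vector_integral M F (indicator A) = F A"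
proof -
  have AM: "A \<subseteq> space M" by (rule sets.sets_into_space[OF A])
  have "simple_vector_integral M F (indicator A) =
      (\<Sum>y\<in>{0, 1}. y *\<^sub>R F (indicator A -` {y} \<inter> space M))"
    unfolding simple_vector_integral_def
  proof (rule sum.mono_neutral_left)
    show "(indicator A :: _ \<Rightarrow> real) ` space M \<subseteq> {0, 1}" by (auto simp: indicator_def)
    show "\<forall>y\<in>{0, 1} - (indicator A :: _ \<Rightarrow> real) ` space M. y *\<^sub>R F (indicator A -` {y} \<inter> space M) = 0"
    proof
      fix y :: real assume "y \<in> {0, 1} - indicator A ` space M"
      then have "indicator A -` {y} \<inter> space M = {}" by auto
      then show "y *\<^sub>R F (indicator A -` {y} \<inter> space M) = 0"
        using vector_measure_empty[OF F] by simp
    qed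
  qed simp
  also have "(indicator A :: _ \<Rightarrow> real) -` {1} \<inter> space M = A"
    using AM by (auto simp: indicator_def)
  then have "(\<Sum>y\<in>{0, 1::real}. y *\<^sub>R F (indicator A -` {y} \<inter> space M)) = F A" by simp
  finally show ?thesis .
qed

lemma simple_vector_integral_AE_zero:
  fixes f :: "'a \<Rightarrow> real"
  assumes "vanishes_on_null_sets M F" and f: "simple_function M f" and "AE x in M. f x = 0"
  shows "simple_vector_integral M F f = 0"
  unfolding simple_vector_integral_def
proof (intro sum.neutral ballI)
  fix y
  show "y *\<^sub>R F (f -` {y} \<inter> space M) = 0"
  proof (cases "y = 0")
    case False
    have "AE x in M. x \<notin> f -` {y} \<inter> space M" using assms(3) by eventually_elim (use False in auto)
    then have "f -` {y} \<inter> space M \<in> null_sets M"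
      using AE_iff_null_sets simple_functionD(2)[OF f] by blast
    then show ?thesis using assms(1) by (simp add: vanishes_on_null_sets_def)
  qed simp
qed

text \<open>The level sets of this list-valued map are the cells of the common refinement of all the
  \<open>s n\<close>.\<close>

lemma simple_function_map:
  assumes "\<And>n. n \<in> set ns \<Longrightarrow> simple_function M (s n)"
  shows "simple_function M (\<lambda>x. map (\<lambda>n. s n x) ns)"
  using assms
proof (induction ns)
  case (Cons n ns)
  then have "simple_function M (\<lambda>x. s n x # map (\<lambda>n. s n x) ns)"
    by (intro simple_function_compose2[where h="(#)"]) auto
  then show ?case by simp
qed simp

section \<open>Estimates in terms of the \<gamma>-variation\<close>

lemma gaussian_sum_moment_le_gamma_variation:
  assumes "\<And>n. n \<in> {1..N} \<Longrightarrow> A n \<in> sets M" "\<And>n. n \<in> {1..N} \<Longrightarrow> measure M (A n) > 0"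
    and "disjoint_family_on A {1..N}"
  shows "ennreal (gaussian_sum_moment P \<gamma> N (\<lambda>n. F (A n) /\<^sub>R sqrt (measure M (A n))))
    \<le> (gamma_variation P \<gamma> M F)\<^sup>2"
proof -
  let ?g = "gaussian_sum_moment P \<gamma> N (\<lambda>n. F (A n) /\<^sub>R sqrt (measure M (A n)))"
  have "ennreal (sqrt ?g) \<le> gamma_variation P \<gamma> M F"
    unfolding gamma_variation_def using assms by (intro Sup_upper) blast
  then have "(ennreal (sqrt ?g))\<^sup>2 \<le> (gamma_variation P \<gamma> M F)\<^sup>2" by (rule power_mono) simp
  then show ?thesis by (simp add: ennreal_power gaussian_sum_moment_nonneg)
qed

lemma L2_inner_simple_function_comp:
  fixes f g :: "'a \<Rightarrow> real"
  assumes "prob_space M" and k: "simple_function M k"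
    and f: "\<And>x. x \<in> space M \<Longrightarrow> f x = \<phi> (k x)" and g: "\<And>x. x \<in> space M \<Longrightarrow> g x = \<psi> (k x)"
  shows "L2_inner M f g = (\<Sum>z\<in>k ` space M. \<phi> z * \<psi> z * measure M (k -` {z} \<inter> space M))"
proof -
  interpret prob_space M by fact
  have fin: "finite (k ` space M)" by (rule simple_functionD(1)[OF k])
  have meas: "k -` {z} \<inter> space M \<in> sets M" for z by (rule simple_functionD(2)[OF k])
  have "L2_inner M f g = (\<integral>x. (\<Sum>z\<in>k ` space M. \<phi> z * \<psi> z * indicator (k -` {z} \<inter> space M) x) \<partial>M)"
    unfolding L2_inner_def
  proof (rule Bochner_Integration.integral_cong[OF refl])
    fix x assume x: "x \<in> space M"
    have "(\<Sum>z\<in>k ` space M. \<phi> z * \<psi> z * indicator (k -` {z} \<inter> space M) x) =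
        (\<Sum>z\<in>k ` space M. if z = k x then \<phi> z * \<psi> z else 0)"
      using x by (intro sum.cong) (auto simp: indicator_def)
    then show "f x * g x = (\<Sum>z\<in>k ` space M. \<phi> z * \<psi> z * indicator (k -` {z} \<inter> space M) x)"
      using x fin f g by simp
  qed
  also have "\<dots> = (\<Sum>z\<in>k ` space M. \<integral>x. \<phi> z * \<psi> z * indicator (k -` {z} \<inter> space M) x \<partial>M)"
    using meas by (intro Bochner_Integration.integral_sum) (auto simp: emeasure_eq_measure)
  also have "\<dots> = (\<Sum>z\<in>k ` space M. \<phi> z * \<psi> z * measure M (k -` {z} \<inter> space M))"
    using meas by (intro sum.cong) auto
  finally show ?thesis .
qed

text \<open>On a common partition into cells \<open>A j\<close> of positive measure, an orthonormal system of simple functions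
  has orthonormal coordinate rows with respect to the normalised indicators of the cells.\<close>

lemma gauss_moment_simple_orthonormal_le:
  assumes \<gamma>: "gaussian_sequence P \<gamma>" and M: "prob_space M" and F: "vector_measure M F"
    and null: "vanishes_on_null_sets M F"
    and s: "L2_orthonormal M N s" "\<And>n. n \<in> {1..N} \<Longrightarrow> simple_function M (s n)"
  shows "gauss_moment {1..N} (\<lambda>n. simple_vector_integral M F (s n)) 0 \<le> (gamma_variation P \<gamma> M F)\<^sup>2"
proof -
  interpret prob_space M by fact
  define k where "k = (\<lambda>x. map (\<lambda>n. s n x) [1..<Suc N])"
  have k: "simple_function M k" unfolding k_def by (rule simple_function_map) (use s in auto)
  define cell where "cell z = k -` {z} \<inter> space M" for z
  have cell: "cell z \<in> sets M" for z unfolding cell_def by (rule simple_functionD(2)[OF k])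
  \<comment> \<open>\<open>k x\<close> lists the values for 1 to \<open>N\<close>, so
    \<open>s n x\<close> sits at position \<open>n - 1\<close>.\<close>
  define \<phi> where "\<phi> n z = z ! (n - 1)" for n and z :: "real list"
  have \<phi>: "s n x = \<phi> n (k x)" if "n \<in> {1..N}" for n x
    using that by (auto simp: \<phi>_def k_def simp del: upt_Suc)
  \<comment> \<open>Only cells of positive measure are admissible in the variation. Dropping the
    others changes neither integrals nor inner products, by \<open>outside\<close>, which rests on
    the vanishing of \<open>F\<close> on null sets.\<close>
  define Z where "Z = {z\<in>k ` space M. measure M (cell z) > 0}"
  have fin: "finite (k ` space M)" by (rule simple_functionD(1)[OF k])
  then have finZ: "finite Z" by (simp add: Z_def)
  define J where "J = card Z"
  obtain b where b: "bij_betw b {1..J} Z" using ex_bij_betw_nat_finite_1[OF finZ] J_def by blast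
  define A where "A j = cell (b j)" for j
  have bZ: "b j \<in> Z" if "j \<in> {1..J}" for j using b that by (auto simp: bij_betw_def)
  have A_sets: "A j \<in> sets M" for j by (simp add: A_def cell)
  have A_pos: "measure M (A j) > 0" if "j \<in> {1..J}" for j using bZ[OF that] by (simp add: Z_def A_def)
  have A_disj: "disjoint_family_on A {1..J}"
    unfolding disjoint_family_on_def
  proof (intro ballI impI)
    fix i j assume "i \<in> {1..J}" "j \<in> {1..J}" "i \<noteq> j"
    then have "b i \<noteq> b j" by (simp only: inj_on_eq_iff[OF bij_betw_imp_inj_on[OF b]] not_False_eq_True)
    then show "A i \<inter> A j = {}" by (auto simp: A_def cell_def)
  qed
  have outside: "F (cell z) = 0 \<and> measure M (cell z) = 0" if "z \<in> k ` space M - Z" for z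
  proof -
    have "measure M (cell z) = 0" using that measure_nonneg[of M "cell z"] by (auto simp: Z_def)
    then have "cell z \<in> null_sets M" using cell by (simp add: null_sets_def emeasure_eq_measure)
    then show ?thesis using null \<open>measure M (cell z) = 0\<close> by (simp add: vanishes_on_null_sets_def)
  qed
  \<comment> \<open>Up to null cells, \<open>s n\<close> is the combination of the normalised
    indicators of the \<open>A j\<close> with coefficients \<open>c n j\<close>; \<open>x j\<close>
    is what an operator representing \<open>F\<close> would assign to the j-th of them.\<close>
  define c where "c n j = \<phi> n (b j) * sqrt (measure M (A j))" for n j
  define x where "x j = F (A j) /\<^sub>R sqrt (measure M (A j))" for j
  have integral: "simple_vector_integral M F (s n) = (\<Sum>j\<in>{1..J}. c n j *\<^sub>R x j)" if n: "n \<in> {1..N}" for n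
  proof -
    have "simple_vector_integral M F (s n) = (\<Sum>z\<in>k ` space M. \<phi> n z *\<^sub>R F (cell z))"
      unfolding cell_def by (rule simple_vector_integral_comp[OF F k]) (rule \<phi>[OF n])
    also have "\<dots> = (\<Sum>z\<in>Z. \<phi> n z *\<^sub>R F (cell z))"
      by (rule sum.mono_neutral_right) (use fin outside in \<open>auto simp: Z_def\<close>)
    also have "\<dots> = (\<Sum>j\<in>{1..J}. \<phi> n (b j) *\<^sub>R F (cell (b j)))"
      by (rule sum.reindex_bij_betw[OF b, symmetric])
    also have "\<dots> = (\<Sum>j\<in>{1..J}. c n j *\<^sub>R x j)"
    proof (rule sum.cong[OF refl])
      fix j assume "j \<in> {1..J}"
      from A_pos[OF this] show "\<phi> n (b j) *\<^sub>R F (cell (b j)) = c n j *\<^sub>R x j"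
        by (simp add: c_def x_def A_def)
    qed
    finally show ?thesis .
  qed
  have gram: "(\<Sum>j\<in>{1..J}. c n j * c m j) = (if n = m then 1 else 0)"
    if n: "n \<in> {1..N}" and m: "m \<in> {1..N}" for n m
  proof -
    have "L2_inner M (s n) (s m) = (\<Sum>z\<in>k ` space M. \<phi> n z * \<phi> m z * measure M (cell z))"
      unfolding cell_def
      by (rule L2_inner_simple_function_comp[OF M k]) (rule \<phi>[OF n], rule \<phi>[OF m])
    also have "\<dots> = (\<Sum>z\<in>Z. \<phi> n z * \<phi> m z * measure M (cell z))"
      by (rule sum.mono_neutral_right) (use fin outside in \<open>auto simp: Z_def\<close>)
    also have "\<dots> = (\<Sum>j\<in>{1..J}. \<phi> n (b j) * \<phi> m (b j) * measure M (cell (b j)))"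
      by (rule sum.reindex_bij_betw[OF b, symmetric])
    also have "\<dots> = (\<Sum>j\<in>{1..J}. c n j * c m j)"
      by (rule sum.cong) (auto simp: c_def A_def)
    finally show ?thesis using s(1) n m by (simp add: L2_orthonormal_def)
  qed
  have "gauss_moment {1..N} (\<lambda>n. simple_vector_integral M F (s n)) 0 =
      gauss_moment {1..N} (\<lambda>n. \<Sum>j\<in>{1..J}. c n j *\<^sub>R x j) 0"
    by (rule gauss_moment_cong) (rule integral)
  also have "\<dots> \<le> gauss_moment {1..J} x 0"
    by (rule gauss_moment_orthonormal_le) (use gram in auto)
  also have "\<dots> = ennreal (gaussian_sum_moment P \<gamma> J x)"
    by (rule gaussian_sum_moment_eq_gauss_moment[OF \<gamma>, symmetric])
  also have "\<dots> \<le> (gamma_variation P \<gamma> M F)\<^sup>2"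
    unfolding x_def by (rule gaussian_sum_moment_le_gamma_variation) (use A_sets A_pos A_disj in auto)
  finally show ?thesis .
qed

lemma gauss_moment_singleton: "gauss_moment {i} x 0 = ennreal ((norm (x i))\<^sup>2)"
proof -
  have "(\<integral>s. std_normal_density s * s\<^sup>2 \<partial>lborel) = 1"
    using integral_std_normal_moment_even[of 1] by simp
  then have one: "(\<integral>\<^sup>+s. ennreal (std_normal_density s * s\<^sup>2) \<partial>lborel) = 1"
    using integrable_std_normal_moment[of 2] by (subst nn_integral_eq_integral) auto
  have "gauss_moment {i} x 0 = (\<integral>\<^sup>+s. ennreal ((norm (s *\<^sub>R x i))\<^sup>2) \<partial>std_normal)"
    by (subst gauss_moment_insert) auto
  also have "\<dots> = (\<integral>\<^sup>+s. ennreal (std_normal_density s) * ennreal ((norm (s *\<^sub>R x i))\<^sup>2) \<partial>lborel)"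
    by (simp add: nn_integral_density)
  also have "\<dots> = (\<integral>\<^sup>+s. ennreal (std_normal_density s * s\<^sup>2) * ennreal ((norm (x i))\<^sup>2) \<partial>lborel)"
    by (intro nn_integral_cong) (simp add: ennreal_mult[symmetric] power_mult_distrib mult_ac)
  also have "\<dots> = ennreal ((norm (x i))\<^sup>2)"
    by (simp add: nn_integral_multc one)
  finally show ?thesis .
qed

text \<open>The collection consisting of \<open>B\<close> alone: a standard Gaussian has second
  moment 1, so its moment is the squared norm of the normalised value.\<close>

lemma norm_vector_measure_le:
  fixes F :: "'a set \<Rightarrow> 'b::real_normed_vector"
  assumes \<gamma>: "gaussian_sequence P \<gamma>" and v: "gamma_variation P \<gamma> M F = ennreal v" "v \<ge> 0"
    and B: "B \<in> sets M" "measure M B > 0"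
  shows "norm (F B) \<le> v * sqrt (measure M B)"
proof -
  have "ennreal (gaussian_sum_moment P \<gamma> 1 x) = ennreal ((norm (x 1))\<^sup>2)" for x :: "nat \<Rightarrow> 'b"
    unfolding gaussian_sum_moment_eq_gauss_moment[OF \<gamma>] by (simp add: gauss_moment_singleton)
  moreover have "ennreal (gaussian_sum_moment P \<gamma> 1 (\<lambda>_. F B /\<^sub>R sqrt (measure M B))) \<le> (gamma_variation P \<gamma> M F)\<^sup>2"
    by (rule gaussian_sum_moment_le_gamma_variation) (use B in \<open>auto simp: disjoint_family_on_def\<close>)
  ultimately have "ennreal ((norm (F B /\<^sub>R sqrt (measure M B)))\<^sup>2) \<le> (ennreal v)\<^sup>2"
    by (simp only: v(1))
  then have "(norm (F B /\<^sub>R sqrt (measure M B)))\<^sup>2 \<le> v\<^sup>2"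
    using v(2) by (simp add: ennreal_power)
  then have "norm (F B /\<^sub>R sqrt (measure M B)) \<le> v" by (rule power2_le_imp_le) fact
  then show ?thesis using B by (simp add: field_simps)
qed

text \<open>The variation says nothing about a null set \<open>A\<close> directly. But
  \<open>F A\<close> is the difference of \<open>F (B \<union> A)\<close> and
  \<open>F (B - A)\<close>, two sets with the positive measure of \<open>B\<close>, to which the
  square-root estimate applies; now let \<open>B\<close> shrink.\<close>

lemma vanishes_on_null_sets_if_small_sets:
  assumes \<gamma>: "gaussian_sequence P \<gamma>" and M: "prob_space M" and F: "vector_measure M F"
    and v: "gamma_variation P \<gamma> M F = ennreal v" "v \<ge> 0" and small: "has_arbitrarily_small_sets M"
  shows "vanishes_on_null_sets M F"
  unfolding vanishes_on_null_sets_def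
proof
  interpret prob_space M by fact
  fix A assume A: "A \<in> null_sets M"
  then have As: "A \<in> sets M" by auto
  have "norm (F A) \<le> 0 + e" if "e > 0" for e
  proof -
    \<comment> \<open>Chosen so that \<open>2 * (v + 1) * sqrt d = e\<close>; taking
      \<open>v + 1\<close> avoids division by zero when \<open>v = 0\<close>.\<close>
    define d where "d = (e / (2 * (v + 1)))\<^sup>2"
    have "d > 0" unfolding d_def using that v by (simp add: zero_less_power)
    then obtain B where B: "B \<in> sets M" "0 < measure M B" "measure M B < d"
      using small unfolding has_arbitrarily_small_sets_def by blast
    have sq: "sqrt (measure M B) \<le> e / (2 * (v + 1))"
    proof -
      have "sqrt (measure M B) \<le> sqrt d" using B by simp
      also have "\<dots> = e / (2 * (v + 1))" unfolding d_def using that v by simp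
      finally show ?thesis .
    qed
    have BA: "measure M (B - A) = measure M B" "measure M (B \<union> A) = measure M B"
      using A B(1) by (simp_all add: measure_Diff_null_set measure_Un_null_set)
    have "F (A \<union> (B - A)) = F A + F (B - A)"
      using As B by (intro vector_measure_Un[OF F]) auto
    then have "F A = F (B \<union> A) - F (B - A)" by (simp add: Un_commute)
    then have "norm (F A) \<le> norm (F (B \<union> A)) + norm (F (B - A))"
      by (simp add: norm_triangle_ineq4)
    also have "\<dots> \<le> v * sqrt (measure M B) + v * sqrt (measure M B)"
      using norm_vector_measure_le[OF \<gamma> v, of "B \<union> A"] norm_vector_measure_le[OF \<gamma> v, of "B - A"] As B BA
      by (intro add_mono) auto
    also have "\<dots> \<le> 2 * (v + 1) * sqrt (measure M B)" by (simp add: algebra_simps)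
    also have "\<dots> \<le> 2 * (v + 1) * (e / (2 * (v + 1)))"
      using sq v by (intro mult_left_mono) auto
    also have "\<dots> = e" using v by simp
    finally show ?thesis by simp
  qed
  then have "norm (F A) \<le> 0" by (rule field_le_epsilon)
  then show "F A = 0" by simp
qed

lemma norm_simple_vector_integral_le:
  assumes \<gamma>: "gaussian_sequence P \<gamma>" and M: "prob_space M" and F: "vector_measure M F"
    and null: "vanishes_on_null_sets M F"
    and v: "gamma_variation P \<gamma> M F = ennreal v" "v \<ge> 0" and f: "simple_function M f"
  shows "norm (simple_vector_integral M F f) \<le> v * L2_norm M f"
\<comment> \<open>A function of norm zero cannot be normalised; its nonzero level sets are null, so
  its integral vanishes by \<open>null\<close>.\<close>
proof (cases "L2_norm M f = 0")
  case True
  have fL: "f \<in> L2 M" by (rule simple_function_in_L2[OF M f])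
  have "(\<integral>x. (f x)\<^sup>2 \<partial>M) = 0"
    using True L2_norm_square[of M f] by (simp add: L2_inner_def power2_eq_square)
  then have "AE x in M. f x = 0"
    using fL integral_nonneg_eq_0_iff_AE[of M "\<lambda>x. (f x)\<^sup>2"] by (simp add: L2_def)
  then show ?thesis using simple_vector_integral_AE_zero[OF null f] True by simp
next
  case False
  define \<rho> where "\<rho> = L2_norm M f"
  have \<rho>: "\<rho> > 0" using False L2_norm_nonneg[of M f] unfolding \<rho>_def by linarith
  define s where "s = (\<lambda>x. (1 / \<rho>) * f x)"
  have ss: "simple_function M s" unfolding s_def by (intro simple_function_mult simple_function_const f)
  have "L2_norm M s = \<bar>1 / \<rho>\<bar> * \<rho>" unfolding s_def \<rho>_def by (rule L2_norm_cmult)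
  then have "L2_norm M s = 1" using \<rho> by simp
  then have "L2_inner M s s = 1" using L2_norm_square[of M s] by simp
  then have "L2_orthonormal M 1 (\<lambda>_. s)"
    using simple_function_in_L2[OF M ss] by (simp add: L2_orthonormal_def)
  from gauss_moment_simple_orthonormal_le[OF \<gamma> M F null this ss]
  have "ennreal ((norm (simple_vector_integral M F s))\<^sup>2) \<le> (ennreal v)\<^sup>2"
    by (simp add: gauss_moment_singleton v(1))
  then have "(norm (simple_vector_integral M F s))\<^sup>2 \<le> v\<^sup>2" using v(2) by (simp add: ennreal_power)
  then have "norm (simple_vector_integral M F s) \<le> v" by (rule power2_le_imp_le) fact
  moreover have "simple_vector_integral M F s = (1 / \<rho>) *\<^sub>R simple_vector_integral M F f"
    unfolding s_def by (rule simple_vector_integral_cmult[OF F f])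
  ultimately have "norm (simple_vector_integral M F f) / \<rho> \<le> v" using \<rho> by simp
  then show ?thesis using \<rho> by (simp only: \<rho>_def[symmetric] pos_divide_le_eq)
qed

subsection \<open>Operators on square integrable functions\<close>

lemma L2_norm_eq_0_AE:
  assumes "f \<in> L2 M" "AE x in M. f x = 0"
  shows "L2_norm M f = 0"
proof -
  have "(\<integral>x. f x * f x \<partial>M) = (\<integral>x. 0 \<partial>M)"
    using assms L2_measurable[OF assms(1)] by (intro integral_cong_AE) auto
  then show ?thesis by (simp add: L2_norm_def L2_inner_def)
qed

lemma indicator_in_L2:
  assumes "prob_space M" "A \<in> sets M"
  shows "indicator A \<in> L2 M"
  using assms by (intro simple_function_in_L2 simple_function_indicator)

lemma L2_norm_indicator:
  assumes "prob_space M" "A \<in> sets M"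
  shows "(L2_norm M (indicator A))\<^sup>2 = measure M A"
proof -
  interpret prob_space M by fact
  have "L2_inner M (indicator A) (indicator A) = (\<integral>x. indicator A x \<partial>M)"
    unfolding L2_inner_def by (rule Bochner_Integration.integral_cong) (auto simp: indicator_def)
  then show ?thesis using assms(2) by (simp add: L2_norm_square)
qed

context
  fixes M :: "'a measure" and T :: "('a \<Rightarrow> real) \<Rightarrow> 'x::real_normed_vector"
  assumes T: "L2_bounded_operator M T"
begin

lemma L2_operator_add: "f \<in> L2 M \<Longrightarrow> g \<in> L2 M \<Longrightarrow> T (\<lambda>x. f x + g x) = T f + T g"
  using T by (simp add: L2_bounded_operator_def)

lemma L2_operator_cmult: "f \<in> L2 M \<Longrightarrow> T (\<lambda>x. c * f x) = c *\<^sub>R T f"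
  using T by (simp add: L2_bounded_operator_def)

lemma L2_operator_diff: "f \<in> L2 M \<Longrightarrow> g \<in> L2 M \<Longrightarrow> T (\<lambda>x. f x - g x) = T f - T g"
  using L2_operator_add[of f "\<lambda>x. (-1) * g x"] L2_operator_cmult[of g "-1"] L2_cmult[of g M "-1"] by simp

lemma L2_operator_sum:
  assumes "finite I" "\<And>i. i \<in> I \<Longrightarrow> f i \<in> L2 M"
  shows "T (\<lambda>x. \<Sum>i\<in>I. f i x) = (\<Sum>i\<in>I. T (f i))"
  using assms
proof (induction I rule: finite_induct)
  case empty
  show ?case using L2_operator_cmult[of "\<lambda>_. 0" 0] by (simp add: L2_def)
next
  case (insert i I)
  then show ?case using L2_operator_add[of "f i" "\<lambda>x. \<Sum>i\<in>I. f i x"] L2_sum[of I f M] by simp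
qed

lemma L2_operator_cong_AE:
  assumes "f \<in> L2 M" "g \<in> L2 M" "AE x in M. f x = g x"
  shows "T f = T g"
proof -
  obtain K where "\<And>f. f \<in> L2 M \<Longrightarrow> norm (T f) \<le> K * L2_norm M f"
    using T unfolding L2_bounded_operator_def by blast
  moreover have "L2_norm M (\<lambda>x. f x - g x) = 0"
    using assms by (intro L2_norm_eq_0_AE L2_diff) auto
  ultimately have "norm (T (\<lambda>x. f x - g x)) \<le> 0"
    using L2_diff[OF assms(1,2)] by (metis mult_zero_right)
  then show ?thesis using L2_operator_diff[OF assms(1,2)] by simp
qed

lemma L2_operator_tendsto:
  assumes "\<And>k::nat. s k \<in> L2 M" "f \<in> L2 M" "(\<lambda>k. L2_norm M (\<lambda>x. s k x - f x)) \<longlonglongrightarrow> 0"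
  shows "(\<lambda>k. T (s k)) \<longlonglongrightarrow> T f"
proof -
  obtain K where K: "\<And>f. f \<in> L2 M \<Longrightarrow> norm (T f) \<le> K * L2_norm M f"
    using T unfolding L2_bounded_operator_def by blast
  have "(\<lambda>k. T (s k) - T f) \<longlonglongrightarrow> 0"
  proof (rule Lim_null_comparison)
    show "\<forall>\<^sub>F k in sequentially. norm (T (s k) - T f) \<le> K * L2_norm M (\<lambda>x. s k x - f x)"
      using K[OF L2_diff[OF assms(1,2)]] L2_operator_diff[OF assms(1,2)] by simp
    show "(\<lambda>k. K * L2_norm M (\<lambda>x. s k x - f x)) \<longlonglongrightarrow> 0"
      using tendsto_mult_right_zero[OF assms(3)] by simp
  qed
  then show ?thesis by (rule LIM_zero_cancel)
qed

context
  fixes F :: "'a set \<Rightarrow> 'x"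
  assumes M: "prob_space M" and TF: "\<And>A. A \<in> sets M \<Longrightarrow> F A = T (indicator A)"
begin

lemma L2_operator_simple:
  assumes f: "simple_function M f"
  shows "T f = simple_vector_integral M F f"
proof -
  let ?g = "\<lambda>x. \<Sum>y\<in>f ` space M. y * indicator (f -` {y} \<inter> space M) x"
  have sets: "f -` {y} \<inter> space M \<in> sets M" for y by (rule simple_functionD(2)[OF f])
  have fin: "finite (f ` space M)" by (rule simple_functionD(1)[OF f])
  have parts: "(\<lambda>x. y * indicator (f -` {y} \<inter> space M) x) \<in> L2 M" for y
    by (intro L2_cmult indicator_in_L2 M sets)
  have "f x = ?g x" if x: "x \<in> space M" for x
  proof -
    have "?g x = (\<Sum>y\<in>f ` space M. if y = f x then y else 0)"
      using x by (intro sum.cong) (auto simp: indicator_def)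
    then show ?thesis using x fin by simp
  qed
  \<comment> \<open>The two functions agree only on \<open>space M\<close>, so equality of their
    images needs the insensitivity of \<open>T\<close> to null sets.\<close>
  then have "T f = T ?g"
    by (intro L2_operator_cong_AE simple_function_in_L2[OF M f] L2_sum parts AE_I2)
  also have "\<dots> = (\<Sum>y\<in>f ` space M. T (\<lambda>x. y * indicator (f -` {y} \<inter> space M) x))"
    by (rule L2_operator_sum[OF fin]) (rule parts)
  also have "\<dots> = simple_vector_integral M F f"
    unfolding simple_vector_integral_def
    using L2_operator_cmult[OF indicator_in_L2[OF M sets]] TF[OF sets] by simp
  finally show ?thesis .
qed

text \<open>This supplies the null-set condition whenever an operator is given, so that the estimate
  for simple orthonormal systems becomes available.\<close>

lemma vanishes_on_null_sets_if_represented: "vanishes_on_null_sets M F"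
  unfolding vanishes_on_null_sets_def
proof
  fix A assume A: "A \<in> null_sets M"
  then have As: "A \<in> sets M" by auto
  have "AE x in M. indicator A x = (0::real)"
    using AE_not_in[OF A] by eventually_elim simp
  then have "T (indicator A) = T (\<lambda>x. 0 * indicator A x)"
    using indicator_in_L2[OF M As] by (intro L2_operator_cong_AE L2_cmult) auto
  then show "F A = 0" using L2_operator_cmult[OF indicator_in_L2[OF M As], of 0] TF[OF As] by simp
qed

text \<open>The functions \<open>h n\<close> are the normalised indicators; disjointness makes them
  orthogonal, and \<open>T\<close> maps them to the vectors in the definition of the
  variation.\<close>

lemma gamma_variation_le_if_represented:
  assumes C: "gamma_summing_bound P \<gamma> M T C"
  shows "gamma_variation P \<gamma> M F \<le> ennreal C"
  unfolding gamma_variation_def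
proof (rule Sup_least, safe)
  fix N :: nat and A :: "nat \<Rightarrow> 'a set"
  assume A: "\<forall>n\<in>{1..N}. A n \<in> sets M \<and> 0 < measure M (A n)" and disj: "disjoint_family_on A {1..N}"
  define h where "h n = (\<lambda>x. inverse (sqrt (measure M (A n))) * indicator (A n) x :: real)" for n
  have Th: "T (h n) = F (A n) /\<^sub>R sqrt (measure M (A n))" if "n \<in> {1..N}" for n
    using that A unfolding h_def by (simp add: L2_operator_cmult[OF indicator_in_L2[OF M]] TF)
  have inner: "L2_inner M (h i) (h j) = (if i = j then 1 else 0)" if ij: "i \<in> {1..N}" "j \<in> {1..N}" for i j
  proof (cases "i = j")
    case True
    have "L2_inner M (h i) (h i) = (inverse (sqrt (measure M (A i))))\<^sup>2 * (L2_norm M (indicator (A i)))\<^sup>2"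
      unfolding L2_norm_square[symmetric] h_def L2_norm_cmult by (simp add: power_mult_distrib)
    also have "\<dots> = 1"
    proof -
      have "A i \<in> sets M" "measure M (A i) > 0" using A ij by blast+
      then show ?thesis by (simp add: L2_norm_indicator[OF M] power_inverse)
    qed
    finally show ?thesis using True by simp
  next
    case False
    then have "A i \<inter> A j = {}" using disj ij by (auto simp: disjoint_family_on_def)
    then have zero: "h i x * h j x = 0" for x by (auto simp: h_def indicator_def)
    show ?thesis using False unfolding L2_inner_def zero by simp
  qed
  have "L2_orthonormal M N h"
    unfolding L2_orthonormal_def using inner A
    by (auto simp: h_def intro!: L2_cmult indicator_in_L2[OF M])
  then have "gaussian_sum_moment P \<gamma> N (\<lambda>n. T (h n)) \<le> C\<^sup>2"
    using C by (simp add: gamma_summing_bound_def)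
  moreover have "gaussian_sum_moment P \<gamma> N (\<lambda>n. T (h n)) =
      gaussian_sum_moment P \<gamma> N (\<lambda>n. F (A n) /\<^sub>R sqrt (measure M (A n)))"
  proof -
    have "(\<Sum>n=1..N. \<gamma> n \<omega> *\<^sub>R T (h n)) =
        (\<Sum>n=1..N. \<gamma> n \<omega> *\<^sub>R (F (A n) /\<^sub>R sqrt (measure M (A n))))" for \<omega>
      by (rule sum.cong[OF refl]) (simp only: Th)
    then show ?thesis unfolding gaussian_sum_moment_def by (simp only:)
  qed
  ultimately have "sqrt (gaussian_sum_moment P \<gamma> N (\<lambda>n. F (A n) /\<^sub>R sqrt (measure M (A n)))) \<le> C"
    using C by (intro real_le_lsqrt) (auto simp: gamma_summing_bound_def gaussian_sum_moment_nonneg)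
  then show "ennreal (sqrt (gaussian_sum_moment P \<gamma> N (\<lambda>n. F (A n) /\<^sub>R sqrt (measure M (A n))))) \<le> ennreal C"
    by (rule ennreal_leI)
qed

text \<open>The variation controls simple systems only when they are exactly orthonormal, hence the
  approximation by orthonormal simple systems. Continuity of \<open>T\<close> makes the Gaussian
  sums converge at every point of the probability space, which is the input for Fatou's
  lemma.\<close>

lemma gamma_summing_bound_if_represented:
  assumes \<gamma>: "gaussian_sequence P \<gamma>" and F: "vector_measure M F"
    and v: "gamma_variation P \<gamma> M F = ennreal v" "v \<ge> 0"
  shows "gamma_summing_bound P \<gamma> M T v"
  unfolding gamma_summing_bound_def
proof (intro conjI allI impI)
  fix N h assume h: "L2_orthonormal M N h"
  have "\<forall>k. \<exists>s. L2_orthonormal M N s \<and> (\<forall>i\<in>{1..N}. simple_function M (s i)) \<and>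
    (\<forall>i\<in>{1..N}. L2_norm M (\<lambda>x. s i x - h i x) < inverse (real (Suc k)))"
    by (intro allI L2_orthonormal_simple_approximation[OF M h]) simp
  then obtain s where s: "\<And>k. L2_orthonormal M N (s k)"
    "\<And>k i. i \<in> {1..N} \<Longrightarrow> simple_function M (s k i)"
    "\<And>k i. i \<in> {1..N} \<Longrightarrow> L2_norm M (\<lambda>x. s k i x - h i x) < inverse (real (Suc k))"
    by metis
  have lim: "(\<lambda>k. T (s k n)) \<longlonglongrightarrow> T (h n)" if n: "n \<in> {1..N}" for n
  proof (rule L2_operator_tendsto)
    show "(\<lambda>k. L2_norm M (\<lambda>x. s k n x - h n x)) \<longlonglongrightarrow> 0"
    proof (rule Lim_null_comparison)
      show "\<forall>\<^sub>F k in sequentially. norm (L2_norm M (\<lambda>x. s k n x - h n x)) \<le> inverse (real (Suc k))"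
        using s(3)[OF n] by (intro always_eventually allI) (simp add: less_imp_le)
      show "(\<lambda>k. inverse (real (Suc k))) \<longlonglongrightarrow> 0" by (rule LIMSEQ_inverse_real_of_nat)
    qed
    show "h n \<in> L2 M" "\<And>k. s k n \<in> L2 M" using h s(1) n by (auto simp: L2_orthonormal_def)
  qed
  let ?u = "\<lambda>k \<omega>. ennreal ((norm (\<Sum>n=1..N. \<gamma> n \<omega> *\<^sub>R T (s k n)))\<^sup>2)"
  have bound: "(\<integral>\<^sup>+\<omega>. ?u k \<omega> \<partial>P) \<le> ennreal (v\<^sup>2)" for k
  proof -
    have "(\<integral>\<^sup>+\<omega>. ?u k \<omega> \<partial>P) = gauss_moment {1..N} (\<lambda>n. T (s k n)) 0"
      by (simp only: gaussian_sum_moment_eq_nn_integral[OF \<gamma>, symmetric] gaussian_sum_moment_eq_gauss_moment[OF \<gamma>])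
    also have "\<dots> = gauss_moment {1..N} (\<lambda>n. simple_vector_integral M F (s k n)) 0"
      by (rule gauss_moment_cong) (rule L2_operator_simple[OF s(2)])
    also have "\<dots> \<le> (gamma_variation P \<gamma> M F)\<^sup>2"
      by (rule gauss_moment_simple_orthonormal_le[OF \<gamma> M F vanishes_on_null_sets_if_represented s(1,2)])
    finally show ?thesis using v by (simp add: ennreal_power)
  qed
  have "ennreal (gaussian_sum_moment P \<gamma> N (\<lambda>n. T (h n))) =
      (\<integral>\<^sup>+\<omega>. ennreal ((norm (\<Sum>n=1..N. \<gamma> n \<omega> *\<^sub>R T (h n)))\<^sup>2) \<partial>P)"
    by (rule gaussian_sum_moment_eq_nn_integral[OF \<gamma>])
  also have "\<dots> = (\<integral>\<^sup>+\<omega>. liminf (\<lambda>k. ?u k \<omega>) \<partial>P)"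
  proof (rule nn_integral_cong)
    fix \<omega>
    have "(\<lambda>k. ?u k \<omega>) \<longlonglongrightarrow> ennreal ((norm (\<Sum>n=1..N. \<gamma> n \<omega> *\<^sub>R T (h n)))\<^sup>2)"
      by (intro tendsto_intros lim)
    from lim_imp_Liminf[OF _ this]
    show "ennreal ((norm (\<Sum>n=1..N. \<gamma> n \<omega> *\<^sub>R T (h n)))\<^sup>2) = liminf (\<lambda>k. ?u k \<omega>)" by simp
  qed
  also have "\<dots> \<le> liminf (\<lambda>k. \<integral>\<^sup>+\<omega>. ?u k \<omega> \<partial>P)"
  proof (rule nn_integral_liminf)
    fix k
    show "?u k \<in> borel_measurable P"
      using gaussian_sum_measurable[OF \<gamma>, where N=N and x="\<lambda>n. T (s k n)"] by measurable
  qed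
  also have "\<dots> \<le> ennreal (v\<^sup>2)"
    using Liminf_mono[of "\<lambda>k. \<integral>\<^sup>+\<omega>. ?u k \<omega> \<partial>P" "\<lambda>_. ennreal (v\<^sup>2)" sequentially] bound
    by (simp add: Liminf_const)
  finally show "gaussian_sum_moment P \<gamma> N (\<lambda>n. T (h n)) \<le> v\<^sup>2" by simp
qed (rule v)

end

end

section \<open>Extension of the integral from simple functions to all of L2\<close>

lemma gamma_variation_represents:
  fixes F :: "'a set \<Rightarrow> 'x::banach"
  assumes \<gamma>: "gaussian_sequence P \<gamma>" and M: "prob_space M" and F: "vector_measure M F"
    and null: "vanishes_on_null_sets M F" and v: "gamma_variation P \<gamma> M F = ennreal v" "v \<ge> 0"
  shows "\<exists>T. L2_bounded_operator M T \<and> (\<forall>A\<in>sets M. F A = T (indicator A))"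
proof -
  let ?I = "simple_vector_integral M F"
  \<comment> \<open>Extension by density and completeness: simple sequences converging in
    \<open>L2_norm\<close> have Cauchy integrals by \<open>diff_le\<close>, and the limit exists
    because \<open>'x\<close> is a Banach space.\<close>
  define approximates where "approximates f s \<longleftrightarrow> (\<forall>k. simple_function M (s k) \<and> s k \<in> L2 M) \<and>
    (\<lambda>k. L2_norm M (\<lambda>x. s k x - f x)) \<longlonglongrightarrow> 0" for f :: "'a \<Rightarrow> real" and s :: "nat \<Rightarrow> 'a \<Rightarrow> real"
  have approx_ex: "\<exists>s. approximates f s" if "f \<in> L2 M" for f
    by (rule L2_simple_approximation[OF that]) (auto simp: approximates_def)
  have diff_le: "norm (?I f - ?I g) \<le> v * L2_norm M (\<lambda>x. f x - g x)"
    if "simple_function M f" "simple_function M g" for f g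
    using norm_simple_vector_integral_le[OF \<gamma> M F null v, of "\<lambda>x. f x - g x"] that
    by (simp add: simple_vector_integral_diff[OF F])
  have conv: "convergent (\<lambda>k. ?I (s k))" if f: "f \<in> L2 M" and s: "approximates f s" for f s
  proof -
    let ?d = "\<lambda>k. v * L2_norm M (\<lambda>x. s k x - f x)"
    have "?d \<longlonglongrightarrow> 0" using s tendsto_mult_right_zero[of _ sequentially v] by (simp add: approximates_def)
    have "Cauchy (\<lambda>k. ?I (s k))"
    proof (rule metric_CauchyI)
      fix e :: real assume "e > 0"
      then have "\<forall>\<^sub>F k in sequentially. ?d k < e / 2"
        using \<open>?d \<longlonglongrightarrow> 0\<close> by (intro order_tendstoD) auto
      then obtain K where K: "\<And>k. k \<ge> K \<Longrightarrow> ?d k < e / 2" unfolding eventually_sequentially by blast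
      have "dist (?I (s m)) (?I (s n)) < e" if "m \<ge> K" "n \<ge> K" for m n
      proof -
        have "L2_norm M (\<lambda>x. s m x - s n x) \<le> L2_norm M (\<lambda>x. s m x - f x) + L2_norm M (\<lambda>x. f x - s n x)"
          using s f by (intro L2_norm_diff_triangle) (auto simp: approximates_def)
        then have "v * L2_norm M (\<lambda>x. s m x - s n x) \<le> ?d m + ?d n"
          using v(2) L2_norm_minus_commute[of M f "s n"]
          by (metis distrib_left mult_left_mono)
        moreover have "norm (?I (s m) - ?I (s n)) \<le> v * L2_norm M (\<lambda>x. s m x - s n x)"
          using s by (intro diff_le) (auto simp: approximates_def)
        ultimately show ?thesis using K[OF that(1)] K[OF that(2)] by (simp add: dist_norm)
      qed
      then show "\<exists>K. \<forall>m\<ge>K. \<forall>n\<ge>K. dist (?I (s m)) (?I (s n)) < e" by blast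
    qed
    then show ?thesis by (rule Cauchy_convergent)
  qed
  \<comment> \<open>The sequence is an arbitrary choice; \<open>T_lim\<close> shows that every
    approximating sequence has the same limit. Linearity depends on this, since the sum of the
    sequences chosen for two functions need not be the one chosen for their sum.\<close>
  define T where "T f = lim (\<lambda>k. ?I ((SOME s. approximates f s) k))" for f
  have T_lim: "(\<lambda>k. ?I (s k)) \<longlonglongrightarrow> T f" if f: "f \<in> L2 M" and s: "approximates f s" for f s
  proof -
    define r where "r = (SOME s. approximates f s)"
    have r: "approximates f r" unfolding r_def by (rule someI_ex[OF approx_ex[OF f]])
    have rT: "(\<lambda>k. ?I (r k)) \<longlonglongrightarrow> T f"
      using conv[OF f r] unfolding T_def r_def[symmetric] by (simp add: convergent_LIMSEQ_iff)
    have "(\<lambda>k. ?I (s k) - ?I (r k)) \<longlonglongrightarrow> 0"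
    proof (rule Lim_null_comparison)
      have "norm (?I (s k) - ?I (r k)) \<le> v * (L2_norm M (\<lambda>x. s k x - f x) + L2_norm M (\<lambda>x. r k x - f x))" for k
      proof -
        have "norm (?I (s k) - ?I (r k)) \<le> v * L2_norm M (\<lambda>x. s k x - r k x)"
          using s r by (intro diff_le) (auto simp: approximates_def)
        also have "L2_norm M (\<lambda>x. s k x - r k x) \<le> L2_norm M (\<lambda>x. s k x - f x) + L2_norm M (\<lambda>x. r k x - f x)"
          using L2_norm_diff_triangle[of "s k" M f "r k"] s r f L2_norm_minus_commute[of M f "r k"]
          by (simp add: approximates_def)
        finally show ?thesis using v(2) by (simp add: mult_left_mono)
      qed
      then show "\<forall>\<^sub>F k in sequentially. norm (?I (s k) - ?I (r k)) \<le>
          v * (L2_norm M (\<lambda>x. s k x - f x) + L2_norm M (\<lambda>x. r k x - f x))" by simp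
      show "(\<lambda>k. v * (L2_norm M (\<lambda>x. s k x - f x) + L2_norm M (\<lambda>x. r k x - f x))) \<longlonglongrightarrow> 0"
        using s r by (intro tendsto_mult_right_zero tendsto_add_zero) (auto simp: approximates_def)
    qed
    from tendsto_add[OF this rT] show ?thesis by simp
  qed
  have T_simple: "T f = ?I f" if f: "simple_function M f" for f
  proof -
    have fL: "f \<in> L2 M" by (rule simple_function_in_L2[OF M f])
    have "approximates f (\<lambda>_. f)"
      using f fL by (simp add: approximates_def L2_norm_def L2_inner_def)
    from T_lim[OF fL this] show ?thesis by (simp add: LIMSEQ_const_iff)
  qed
  have T_add: "T (\<lambda>x. f x + g x) = T f + T g" if f: "f \<in> L2 M" and g: "g \<in> L2 M" for f g
  proof -
    obtain s r where s: "approximates f s" and r: "approximates g r" using approx_ex f g by blast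
    have "(\<lambda>k. L2_norm M (\<lambda>x. (s k x + r k x) - (f x + g x))) \<longlonglongrightarrow> 0"
    proof (rule Lim_null_comparison)
      have "norm (L2_norm M (\<lambda>x. (s k x + r k x) - (f x + g x))) \<le>
          L2_norm M (\<lambda>x. s k x - f x) + L2_norm M (\<lambda>x. r k x - g x)" for k
        using L2_norm_triangle[of "\<lambda>x. s k x - f x" M "\<lambda>x. r k x - g x"] s r f g
        by (simp add: approximates_def L2_diff algebra_simps)
      then show "\<forall>\<^sub>F k in sequentially. norm (L2_norm M (\<lambda>x. (s k x + r k x) - (f x + g x))) \<le>
          L2_norm M (\<lambda>x. s k x - f x) + L2_norm M (\<lambda>x. r k x - g x)" by simp
      show "(\<lambda>k. L2_norm M (\<lambda>x. s k x - f x) + L2_norm M (\<lambda>x. r k x - g x)) \<longlonglongrightarrow> 0"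
        using s r by (intro tendsto_add_zero) (auto simp: approximates_def)
    qed
    then have "approximates (\<lambda>x. f x + g x) (\<lambda>k x. s k x + r k x)"
      using s r by (auto simp: approximates_def intro!: L2_add simple_function_add)
    from T_lim[OF L2_add[OF f g] this]
    have "(\<lambda>k. ?I (s k) + ?I (r k)) \<longlonglongrightarrow> T (\<lambda>x. f x + g x)"
      using s r by (simp add: approximates_def simple_vector_integral_add[OF F])
    moreover have "(\<lambda>k. ?I (s k) + ?I (r k)) \<longlonglongrightarrow> T f + T g"
      by (intro tendsto_add T_lim f g s r)
    ultimately show ?thesis by (rule LIMSEQ_unique)
  qed
  have T_cmult: "T (\<lambda>x. c * f x) = c *\<^sub>R T f" if f: "f \<in> L2 M" for f c
  proof -
    obtain s where s: "approximates f s" using approx_ex f by blast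
    have "L2_norm M (\<lambda>x. c * s k x - c * f x) = \<bar>c\<bar> * L2_norm M (\<lambda>x. s k x - f x)" for k
      using L2_norm_cmult[of M c "\<lambda>x. s k x - f x"] by (simp add: right_diff_distrib)
    then have "approximates (\<lambda>x. c * f x) (\<lambda>k x. c * s k x)"
      using s by (auto simp: approximates_def intro!: L2_cmult simple_function_mult tendsto_mult_right_zero)
    from T_lim[OF L2_cmult[OF f] this]
    have "(\<lambda>k. c *\<^sub>R ?I (s k)) \<longlonglongrightarrow> T (\<lambda>x. c * f x)"
      using s by (simp add: approximates_def simple_vector_integral_cmult[OF F])
    moreover have "(\<lambda>k. c *\<^sub>R ?I (s k)) \<longlonglongrightarrow> c *\<^sub>R T f"
      by (intro tendsto_scaleR tendsto_const T_lim f s)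
    ultimately show ?thesis by (rule LIMSEQ_unique)
  qed
  have T_le: "norm (T f) \<le> v * L2_norm M f" if f: "f \<in> L2 M" for f
  proof -
    obtain s where s: "approximates f s" using approx_ex f by blast
    show ?thesis
    proof (rule tendsto_le)
      show "(\<lambda>k. norm (?I (s k))) \<longlonglongrightarrow> norm (T f)" by (intro tendsto_norm T_lim f s)
      show "(\<lambda>k. v * (L2_norm M (\<lambda>x. s k x - f x) + L2_norm M f)) \<longlonglongrightarrow> v * L2_norm M f"
        using s tendsto_mult_left[OF tendsto_add[OF _ tendsto_const]]
        by (fastforce simp: approximates_def intro!: tendsto_eq_intros)
      have "norm (?I (s k)) \<le> v * (L2_norm M (\<lambda>x. s k x - f x) + L2_norm M f)" for k
      proof -
        have "norm (?I (s k)) \<le> v * L2_norm M (s k)"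
          using s by (intro norm_simple_vector_integral_le[OF \<gamma> M F null v]) (simp add: approximates_def)
        also have "L2_norm M (s k) \<le> L2_norm M (\<lambda>x. s k x - f x) + L2_norm M f"
          using L2_norm_triangle[of "\<lambda>x. s k x - f x" M f] s f by (simp add: approximates_def L2_diff)
        finally show ?thesis using v(2) by (simp add: mult_left_mono)
      qed
      then show "\<forall>\<^sub>F k in sequentially. norm (?I (s k)) \<le> v * (L2_norm M (\<lambda>x. s k x - f x) + L2_norm M f)"
        by simp
    qed simp
  qed
  have "L2_bounded_operator M T"
    unfolding L2_bounded_operator_def using T_add T_cmult T_le by blast
  moreover have "F A = T (indicator A)" if "A \<in> sets M" for A
    using that by (simp add: T_simple simple_vector_integral_indicator[OF F])
  ultimately show ?thesis by blast
qed

theorem theorem2p3: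
  fixes P :: "'w measure" and \<gamma> :: "nat \<Rightarrow> 'w \<Rightarrow> real"
    and M :: "'a measure" and F :: "'a set \<Rightarrow> 'x::banach"
  assumes "gaussian_sequence P \<gamma>"
    and "prob_space M"
    and "vector_measure M F"
    and "vanishes_on_null_sets M F \<or> has_arbitrarily_small_sets M"
  shows "(bounded_gamma_variation P \<gamma> M F \<longleftrightarrow>
            (\<exists>T. gamma_summing P \<gamma> M T \<and> (\<forall>A\<in>sets M. F A = T (indicator A)))) \<and>
         (\<forall>T. gamma_summing P \<gamma> M T \<and> (\<forall>A\<in>sets M. F A = T (indicator A)) \<longrightarrow>
            gamma_variation P \<gamma> M F = ennreal (gamma_summing_norm P \<gamma> M T))"
proof (intro conjI iffI allI impI)
  assume "bounded_gamma_variation P \<gamma> M F"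
  then obtain v where v: "gamma_variation P \<gamma> M F = ennreal v" "v \<ge> 0"
    unfolding bounded_gamma_variation_def by (cases "gamma_variation P \<gamma> M F") auto
  have "vanishes_on_null_sets M F"
    using assms vanishes_on_null_sets_if_small_sets[OF assms(1-3) v] by blast
  from gamma_variation_represents[OF assms(1-3) this v] obtain T
    where T: "L2_bounded_operator M T" "\<forall>A\<in>sets M. F A = T (indicator A)" by blast
  have "gamma_summing_bound P \<gamma> M T v"
    by (rule gamma_summing_bound_if_represented[OF T(1) assms(2) _ assms(1,3) v]) (use T(2) in blast)
  with T show "\<exists>T. gamma_summing P \<gamma> M T \<and> (\<forall>A\<in>sets M. F A = T (indicator A))"
    unfolding gamma_summing_def by blast
next
  assume "\<exists>T. gamma_summing P \<gamma> M T \<and> (\<forall>A\<in>sets M. F A = T (indicator A))"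
  then obtain T C where T: "L2_bounded_operator M T" "gamma_summing_bound P \<gamma> M T C"
    "\<And>A. A \<in> sets M \<Longrightarrow> F A = T (indicator A)"
    unfolding gamma_summing_def by blast
  have "gamma_variation P \<gamma> M F \<le> ennreal C"
    by (rule gamma_variation_le_if_represented[OF T(1) assms(2) T(3) T(2)])
  then show "bounded_gamma_variation P \<gamma> M F"
    unfolding bounded_gamma_variation_def using ennreal_less_top le_less_trans by (simp add: le_less_trans)
next
  fix T assume "gamma_summing P \<gamma> M T \<and> (\<forall>A\<in>sets M. F A = T (indicator A))"
  then obtain C where T: "L2_bounded_operator M T" "gamma_summing_bound P \<gamma> M T C"
    "\<And>A. A \<in> sets M \<Longrightarrow> F A = T (indicator A)"
    unfolding gamma_summing_def by blast
  note le = gamma_variation_le_if_represented[OF T(1) assms(2) T(3)]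
  from le[OF _ T(2)] obtain v where v: "gamma_variation P \<gamma> M F = ennreal v" "v \<ge> 0"
    by (cases "gamma_variation P \<gamma> M F") (auto simp: top_unique)
  have "gamma_summing_norm P \<gamma> M T = v"
    unfolding gamma_summing_norm_def
  \<comment> \<open>The infimum is attained: the variation \<open>v\<close> is itself a
    \<gamma>-summing bound, and it lies below every other one by the inequality
    \<open>le\<close>.\<close>
  proof (rule cInf_eq_minimum)
    show "v \<in> {C. gamma_summing_bound P \<gamma> M T C}"
      using gamma_summing_bound_if_represented[OF T(1) assms(2) T(3) assms(1,3) v] by simp
    fix D assume "D \<in> {C. gamma_summing_bound P \<gamma> M T C}"
    then have D: "gamma_summing_bound P \<gamma> M T D" by simp
    then have "D \<ge> 0" by (simp add: gamma_summing_bound_def)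
    then show "v \<le> D" using le[OF _ D] v by simp
  qed
  with v show "gamma_variation P \<gamma> M F = ennreal (gamma_summing_norm P \<gamma> M T)" by simp
qed

end
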